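(* Let $U,V$ be nonlocal vertex algebras and $R(x)$ a twisting operator for $(U,V)$. Let $K$ be a nonlocal vertex algebra and let $\psi_1:U\to K$, $\psi_2:V\to K$ be homomorphisms of nonlocal vertex algebras such that for all $u\in U$, $v\in V$, $$Y(\psi_1(u),x)\psi_2(v)\in K[[x]],\qquad Y(\psi_2(v),x)\psi_1(u)=e^{x\mathcal D}\sum_{i=1}^r f_i(-x)\,Y(\psi_1(u_i),-x)\psi_2(v_i),$$ where $R(x)(v\otimes u)=\sum_{i=1}^r u_i\otimes v_i\otimes f_i(x)$ and $\mathcal D$ is the $\mathcal D$-operator of $K$. Then the linear map $\psi:U\otimes_RV\to K$ defined by $\psi(u\otimes v)=\psi_1(u)_{-1}\psi_2(v)$ is a homomorphism of nonlocal vertex algebras extending $\psi_1$ and $\psi_2$ (i.e. $\psi(u\otimes\mathbf 1)=\psi_1(u)$, $\psi(\mathbf 1\otimes v)=\psi_2(v)$), and it is the unique such homomorphism.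
   Context: All vector spaces are over $\mathbb{C}$. A nonlocal vertex algebra is a vector space $V$ with a linear map $Y(\cdot,x):V\to \mathrm{Hom}(V,V((x)))$, $v\mapsto Y(v,x)=\sum_{n\in\mathbb Z}v_nx^{-n-1}$, and a vector $\mathbf 1\in V$ such that for all $v$: $Y(\mathbf 1,x)v=v$, $Y(v,x)\mathbf 1\in V[[x]]$, $\lim_{x\to0}Y(v,x)\mathbf 1=v$; and for all $u,v,w$ there is $k\ge0$ with $(x_0+x_2)^kY(u,x_0+x_2)Y(v,x_2)w=(x_0+x_2)^kY(Y(u,x_0)v,x_2)w$. Homomorphisms preserve vacuum and vertex operators. Write $Y(x)(u\otimes v)=Y(u,x)v$; $\mathcal Dv=v_{-2}\mathbf 1$. Conventions: $f(x_1\pm x_2)$ for $f\in\mathbb C((x))$ is expanded in nonnegative powers of the second variable; $T^{ij}$ denotes $T$ acting on tensor factors $i,j$; maps are extended linearly over scalar series. Twisting operator for $(U,V)$: a linear map $R(x):V\otimes U\to U\otimes V\otimes\mathbb C((x))$ such that $R(x)(v\otimes\mathbf 1)=\mathbf 1\otimes v$, $R(x)(\mathbf 1\otimes u)=u\otimes\mathbf 1$, $R(x_1)(1\otimes Y(x_2))=(Y(x_2)\otimes1)R^{23}(x_1)R^{12}(x_1+x_2)$ on $V\otimes U\otimes U$, and $R(x_1)(Y(x_2)\otimes 1)=(1\otimes Y(x_2))R^{12}(x_1-x_2)R^{23}(x_1)$ on $V\otimes V\otimes U$. Twisted tensor product $U\otimes_RV$: the nonlocal vertex algebra on $U\otimes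 V$ with vacuum $\mathbf 1\otimes\mathbf 1$ and $Y_R(u\otimes v,x)(u'\otimes v')=\sum_i f_i(-x)Y(u,x)u'_i\otimes Y(v_i,x)v'$ where $R(x)(v\otimes u')=\sum_i u'_i\otimes v_i\otimes f_i(x)$. *)

theory Defs
  imports Complex_Main "HOL-Library.Groups_Big_Fun"
begin

text \<open>A complex vector space is a type of class ab_group_add together with a scalar
multiplication by complex numbers satisfying the vector space axioms.
Vertex operators are encoded by their modes: vop V v n w = v_n w, so that
Y(v,x)w = sum over n of (vop V v n w) x^(-n-1).\<close>

record 'a nlva_data =
  scal :: "complex \<Rightarrow> 'a \<Rightarrow> 'a"
  vop  :: "'a \<Rightarrow> int \<Rightarrow> 'a \<Rightarrow> 'a"
  vac  :: 'a

text \<open>Coefficient of x0^a x2^b in Y(u,x0+x2)Y(v,x2)w, where (x0+x2)^p is expanded in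
nonnegative powers of x2:  sum over j>=0 of binom(a+j,j) u_(-a-1-j) v_(j-b-1) w.\<close>
definition prod_coeff :: "('a::ab_group_add) nlva_data \<Rightarrow> 'a \<Rightarrow> 'a \<Rightarrow> 'a \<Rightarrow> int \<Rightarrow> int \<Rightarrow> 'a" where
  "prod_coeff V u v w a b =
     Sum_any (\<lambda>j::nat. scal V ((of_int (a + int j) :: complex) gchoose j)
                 (vop V u (- a - 1 - int j) (vop V v (int j - b - 1) w)))"

text \<open>Coefficient of x0^a x2^b in Y(Y(u,x0)v,x2)w.\<close>
definition iter_coeff :: "('a::ab_group_add) nlva_data \<Rightarrow> 'a \<Rightarrow> 'a \<Rightarrow> 'a \<Rightarrow> int \<Rightarrow> int \<Rightarrow> 'a" where
  "iter_coeff V u v w a b = vop V (vop V u (- a - 1) v) (- b - 1) w"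

text \<open>Coefficient of x0^a x2^b in (x0+x2)^k F(x0,x2), F given by its coefficients.\<close>
definition mult_binom_coeff :: "('a::ab_group_add) nlva_data \<Rightarrow> nat \<Rightarrow> (int \<Rightarrow> int \<Rightarrow> 'a) \<Rightarrow> int \<Rightarrow> int \<Rightarrow> 'a" where
  "mult_binom_coeff V k F a b =
     (\<Sum>i\<le>k. scal V (of_nat (k choose i)) (F (a - int i) (b - int (k - i))))"

definition nlva :: "('a::ab_group_add) nlva_data \<Rightarrow> bool" where
  "nlva V \<longleftrightarrow>
     vector_space (scal V) \<and>
     \<comment> \<open>Y is a linear map V -> Hom(V, V((x)))\<close>
     (\<forall>n w. Vector_Spaces.linear (scal V) (scal V) (\<lambda>v. vop V v n w)) \<and>
     (\<forall>v n. Vector_Spaces.linear (scal V) (scal V) (vop V v n)) \<and>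
     (\<forall>v w. \<exists>N. \<forall>n. n > N \<longrightarrow> vop V v n w = 0) \<and>
     \<comment> \<open>vacuum property Y(1,x)v = v\<close>
     (\<forall>v n. vop V (vac V) n v = (if n = -1 then v else 0)) \<and>
     \<comment> \<open>creation property: Y(v,x)1 in V[[x]] and its constant term is v\<close>
     (\<forall>v n. n \<ge> 0 \<longrightarrow> vop V v n (vac V) = 0) \<and>
     (\<forall>v. vop V v (-1) (vac V) = v) \<and>
     \<comment> \<open>weak associativity\<close>
     (\<forall>u v w. \<exists>k::nat. \<forall>a b.
         mult_binom_coeff V k (prod_coeff V u v w) a b =
         mult_binom_coeff V k (iter_coeff V u v w) a b)"

definition Dop :: "'a nlva_data \<Rightarrow> 'a \<Rightarrow> 'a" where
  "Dop V v = vop V v (-2) (vac V)"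

definition hom_on :: "'s set \<Rightarrow> ('s \<Rightarrow> 's \<Rightarrow> 's) \<Rightarrow> (complex \<Rightarrow> 's \<Rightarrow> 's)
     \<Rightarrow> ('s \<Rightarrow> int \<Rightarrow> 's \<Rightarrow> 's) \<Rightarrow> 's \<Rightarrow> ('k::ab_group_add) nlva_data \<Rightarrow> ('s \<Rightarrow> 'k) \<Rightarrow> bool" where
  "hom_on S add sc Y one K f \<longleftrightarrow>
     (\<forall>a\<in>S. \<forall>b\<in>S. f (add a b) = f a + f b) \<and>
     (\<forall>c. \<forall>a\<in>S. f (sc c a) = scal K c (f a)) \<and>
     f one = vac K \<and>
     (\<forall>a\<in>S. \<forall>b\<in>S. \<forall>n. f (Y a n b) = vop K (f a) n (f b))"

definition nlva_hom :: "('a::ab_group_add) nlva_data \<Rightarrow> ('k::ab_group_add) nlva_data \<Rightarrow> ('a \<Rightarrow> 'k) \<Rightarrow> bool" where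
  "nlva_hom A K f = hom_on UNIV (+) (scal A) (vop A) (vac A) K f"

text \<open>The tensor product U (x) V is realised as the span of the elementary tensors inside
the functions on the (complex-valued) bilinear forms on U x V: an element
sum_i u_i (x) v_i is identified with B |-> sum_i B u_i v_i (and with 0 on non-bilinear
arguments).  Since the bilinear forms are the dual of U (x) V, this is a faithful
(injective) realisation of the algebraic tensor product.\<close>

type_synonym ('u, 'v) tensor = "('u \<Rightarrow> 'v \<Rightarrow> complex) \<Rightarrow> complex"

definition bilin :: "('u::ab_group_add) nlva_data \<Rightarrow> ('v::ab_group_add) nlva_data
     \<Rightarrow> ('u \<Rightarrow> 'v \<Rightarrow> complex) \<Rightarrow> bool" where
  "bilin U V B \<longleftrightarrow>
     (\<forall>v. Vector_Spaces.linear (scal U) times (\<lambda>u. B u v)) \<and>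
     (\<forall>u. Vector_Spaces.linear (scal V) times (B u))"

definition tens :: "('u::ab_group_add) nlva_data \<Rightarrow> ('v::ab_group_add) nlva_data
     \<Rightarrow> 'u \<Rightarrow> 'v \<Rightarrow> ('u, 'v) tensor" where
  "tens U V u v = (\<lambda>B. if bilin U V B then B u v else 0)"

definition tadd :: "('u, 'v) tensor \<Rightarrow> ('u, 'v) tensor \<Rightarrow> ('u, 'v) tensor" where
  "tadd s t = (\<lambda>B. s B + t B)"

definition tscale :: "complex \<Rightarrow> ('u, 'v) tensor \<Rightarrow> ('u, 'v) tensor" where
  "tscale c t = (\<lambda>B. c * t B)"

definition tspace :: "('u::ab_group_add) nlva_data \<Rightarrow> ('v::ab_group_add) nlva_data
     \<Rightarrow> ('u, 'v) tensor set" where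
  "tspace U V = {t. \<exists>(r::nat) us vs. t = (\<lambda>B. \<Sum>i<r. tens U V (us i) (vs i) B)}"

text \<open>A map R(x) : V (x) U -> U (x) V (x) C((x)) is encoded by its coefficients:
R n t is the coefficient of x^n in R(x)t, so R(x)t = sum_n (R n t) x^n.
Scalar series f(x) are encoded as coefficient functions int => complex with
support bounded below.\<close>

definition laurent :: "(int \<Rightarrow> complex) \<Rightarrow> bool" where
  "laurent f \<longleftrightarrow> (\<exists>N. \<forall>k. k < N \<longrightarrow> f k = 0)"

definition R_decomp :: "('u::ab_group_add) nlva_data \<Rightarrow> ('v::ab_group_add) nlva_data
     \<Rightarrow> (int \<Rightarrow> ('v, 'u) tensor \<Rightarrow> ('u, 'v) tensor) \<Rightarrow> ('v, 'u) tensor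
     \<Rightarrow> nat \<Rightarrow> (nat \<Rightarrow> 'u) \<Rightarrow> (nat \<Rightarrow> 'v) \<Rightarrow> (nat \<Rightarrow> int \<Rightarrow> complex) \<Rightarrow> bool" where
  "R_decomp U V R t r us vs fs \<longleftrightarrow>
     (\<forall>i<r. laurent (fs i)) \<and>
     (\<forall>k. R k t = (\<lambda>B. \<Sum>i<r. fs i k * tens U V (us i) (vs i) B))"

text \<open>Coefficient of x1^a x2^b (a bilinear form Bf on U x V applied) of
(Y(x2) (x) 1) R^23(x1) R^12(x1+x2) (v (x) u (x) u').\<close>
definition hex1_rhs :: "('u::ab_group_add) nlva_data \<Rightarrow> ('v::ab_group_add) nlva_data
     \<Rightarrow> (int \<Rightarrow> ('v, 'u) tensor \<Rightarrow> ('u, 'v) tensor) \<Rightarrow> 'v \<Rightarrow> 'u \<Rightarrow> 'u \<Rightarrow> int \<Rightarrow> int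
     \<Rightarrow> ('u \<Rightarrow> 'v \<Rightarrow> complex) \<Rightarrow> complex" where
  "hex1_rhs U V R v u u' a b Bf =
     Sum_any (\<lambda>(j::nat, c::int).
        ((of_int (a - c + int j) :: complex) gchoose j) *
        R (a - c + int j) (tens V U v u)
          (\<lambda>p q. R c (tens V U q u') (\<lambda>p' q'. Bf (vop U p (int j - b - 1) p') q')))"

text \<open>Coefficient of x1^a x2^b (a bilinear form Bf on U x V applied) of
(1 (x) Y(x2)) R^12(x1-x2) R^23(x1) (v (x) v' (x) u).\<close>
definition hex2_rhs :: "('u::ab_group_add) nlva_data \<Rightarrow> ('v::ab_group_add) nlva_data
     \<Rightarrow> (int \<Rightarrow> ('v, 'u) tensor \<Rightarrow> ('u, 'v) tensor) \<Rightarrow> 'v \<Rightarrow> 'v \<Rightarrow> 'u \<Rightarrow> int \<Rightarrow> int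
     \<Rightarrow> ('u \<Rightarrow> 'v \<Rightarrow> complex) \<Rightarrow> complex" where
  "hex2_rhs U V R v v' u a b Bf =
     Sum_any (\<lambda>(j::nat, c::int).
        ((of_int (a - c + int j) :: complex) gchoose j) * (-1) ^ j *
        R c (tens V U v' u)
          (\<lambda>p q. R (a - c + int j) (tens V U v p) (\<lambda>p' q'. Bf p' (vop V q' (int j - b - 1) q))))"

definition twisting_operator :: "('u::ab_group_add) nlva_data \<Rightarrow> ('v::ab_group_add) nlva_data
     \<Rightarrow> (int \<Rightarrow> ('v, 'u) tensor \<Rightarrow> ('u, 'v) tensor) \<Rightarrow> bool" where
  "twisting_operator U V R \<longleftrightarrow>
     \<comment> \<open>R(x) is a linear map V (x) U -> U (x) V (x) C((x))\<close>
     (\<forall>n. \<forall>t\<in>tspace V U. R n t \<in> tspace U V) \<and>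
     (\<forall>n. \<forall>s\<in>tspace V U. \<forall>t\<in>tspace V U. R n (tadd s t) = tadd (R n s) (R n t)) \<and>
     (\<forall>n c. \<forall>t\<in>tspace V U. R n (tscale c t) = tscale c (R n t)) \<and>
     (\<forall>t\<in>tspace V U. \<exists>r us vs fs. R_decomp U V R t r us vs fs) \<and>
     \<comment> \<open>R(x)(v (x) 1) = 1 (x) v and R(x)(1 (x) u) = u (x) 1\<close>
     (\<forall>v n. R n (tens V U v (vac U)) = (if n = 0 then tens U V (vac U) v else (\<lambda>B. 0))) \<and>
     (\<forall>u n. R n (tens V U (vac V) u) = (if n = 0 then tens U V u (vac V) else (\<lambda>B. 0))) \<and>
     \<comment> \<open>R(x1)(1 (x) Y(x2)) = (Y(x2) (x) 1) R^23(x1) R^12(x1+x2) on V (x) U (x) U\<close>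
     (\<forall>v u u' a b Bf. bilin U V Bf \<longrightarrow>
         R a (tens V U v (vop U u (- b - 1) u')) Bf = hex1_rhs U V R v u u' a b Bf) \<and>
     \<comment> \<open>R(x1)(Y(x2) (x) 1) = (1 (x) Y(x2)) R^12(x1-x2) R^23(x1) on V (x) V (x) U\<close>
     (\<forall>v v' u a b Bf. bilin U V Bf \<longrightarrow>
         R a (tens V U (vop V v (- b - 1) v') u) Bf = hex2_rhs U V R v v' u a b Bf)"

text \<open>Mode n of Y_R(u (x) v, x)(u' (x) v') = sum_i f_i(-x) Y(u,x)u'_i (x) Y(v_i,x)v',
where R(x)(v (x) u') = sum_i u'_i (x) v_i (x) f_i(x); evaluated at a bilinear form B.\<close>
definition YR_pure :: "('u::ab_group_add) nlva_data \<Rightarrow> ('v::ab_group_add) nlva_data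
     \<Rightarrow> (int \<Rightarrow> ('v, 'u) tensor \<Rightarrow> ('u, 'v) tensor)
     \<Rightarrow> 'u \<Rightarrow> 'v \<Rightarrow> int \<Rightarrow> 'u \<Rightarrow> 'v \<Rightarrow> ('u \<Rightarrow> 'v \<Rightarrow> complex) \<Rightarrow> complex" where
  "YR_pure U V R u v n u' v' B =
     Sum_any (\<lambda>(k::int, p::int). ((-1::complex) powi k) *
        R k (tens V U v u') (\<lambda>q q'. B (vop U u p q) (vop V q' (n + k - 1 - p) v')))"

text \<open>Bilinear extension to all of U (x) V.\<close>
definition YR :: "('u::ab_group_add) nlva_data \<Rightarrow> ('v::ab_group_add) nlva_data
     \<Rightarrow> (int \<Rightarrow> ('v, 'u) tensor \<Rightarrow> ('u, 'v) tensor)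
     \<Rightarrow> ('u, 'v) tensor \<Rightarrow> int \<Rightarrow> ('u, 'v) tensor \<Rightarrow> ('u, 'v) tensor" where
  "YR U V R t n t' =
     (\<lambda>B. if bilin U V B
          then t (\<lambda>u v. t' (\<lambda>u' v'. YR_pure U V R u v n u' v' B))
          else 0)"

text \<open>Coefficient of x^m in sum_(i<r) fs_i(-x) Y(psi1(us_i),-x) psi2(vs_i).\<close>
definition skew_series :: "('k::ab_group_add) nlva_data \<Rightarrow> ('u \<Rightarrow> 'k) \<Rightarrow> ('v \<Rightarrow> 'k)
     \<Rightarrow> nat \<Rightarrow> (nat \<Rightarrow> 'u) \<Rightarrow> (nat \<Rightarrow> 'v) \<Rightarrow> (nat \<Rightarrow> int \<Rightarrow> complex) \<Rightarrow> int \<Rightarrow> 'k" where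
  "skew_series K psi1 psi2 r us vs fs m =
     (\<Sum>i<r. Sum_any (\<lambda>k::int. scal K (fs i k * (-1::complex) powi m)
                (vop K (psi1 (us i)) (k - m - 1) (psi2 (vs i)))))"

text \<open>Coefficient of x^(-n-1) in e^(x D) S(x), S given by its coefficients.\<close>
definition exp_D_coeff :: "('k::ab_group_add) nlva_data \<Rightarrow> (int \<Rightarrow> 'k) \<Rightarrow> int \<Rightarrow> 'k" where
  "exp_D_coeff K S n =
     Sum_any (\<lambda>l::nat. scal K (1 / of_nat (fact l)) ((Dop K ^^ l) (S (- n - 1 - int l))))"

end

(* Write a, a', a_i for elements of U and b, b', c_i for elements of V, identified with their
   images in K, where R(x)(b (x) a') = sum_i a_i (x) c_i (x) f_i(x).

   Products Y(a,x1)Y(b,x2)w that have no pole in x1, uniformly in x2, satisfy the naive identity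
   Y(a_{-1}b,x)w = Y(a,x)Y(b,x)w. Likewise a_p(a'_{-1}w) = (a_p a')_{-1}w if Y(a',x)w and
   Y(a_m a',x)w are regular. Both follow from weak associativity by cancelling (x0 + x2)^k.
   The skew symmetry hypothesis rewrites Y(Y(b,x0)a',x2)b' as
   sum_i f_i(-x0) Y(a_i,x2) Y(c_i,x2 + x0) b', whence by weak associativity
   Y(b,x)a'_{-1}b' = sum_i f_i(-x) (a_i)_{-1} Y(c_i,x)b'.
   Applying Y(a,x) to this identity gives
   Y(a_{-1}b,x)(a'_{-1}b') = sum_i f_i(-x) (Y(a,x)a_i)_{-1} (Y(c_i,x)b'),
   which is the multiplicativity of psi on elementary tensors. Uniqueness holds because
   u (x) v = (u (x) 1)_{-1} (1 (x) v).

   The map psi is well defined on the tensor product, realised inside the functionals on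
   bilinear forms, because linear functionals separate the points of K. *)
theory Submission imports Defs "HOL-Computational_Algebra.Formal_Power_Series" begin

section \<open>Binomial identities\<close>

definition int_choose :: "nat \<Rightarrow> int \<Rightarrow> complex" where
  "int_choose t s = (if s < 0 then 0 else of_nat t gchoose nat s)"

lemma gchoose_of_int_eq_0:
  assumes "0 \<le> i" "i < int j"
  shows "((of_int i :: complex) gchoose j) = 0"
proof -
  have "(of_int i :: complex) = of_nat (nat i)" using assms by simp
  moreover have "nat i choose j = 0" using assms by (intro binomial_eq_0) linarith
  ultimately show ?thesis by (metis binomial_gbinomial of_nat_0)
qed

text \<open>Vandermonde's convolution. Since \<open>int_choose\<close> vanishes at negative lower
  index, the bound \<open>L\<close> of the sum need not depend on \<open>s\<close>, and later sums
  can be interchanged.\<close>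

lemma sum_gchoose_int_choose:
  assumes "s \<le> int L"
  shows "(\<Sum>l\<le>L. (x gchoose l) * int_choose t (s - int l))
       = (if s < 0 then 0 else (x + of_nat t) gchoose nat s)"
proof (cases "s < 0")
  case True
  then show ?thesis by (simp add: int_choose_def)
next
  case False
  then obtain N where N: "s = int N" by (metis nonneg_int_cases not_less)
  have "(\<Sum>l\<le>L. (x gchoose l) * int_choose t (s - int l))
      = (\<Sum>l\<le>N. (x gchoose l) * int_choose t (s - int l))"
    using assms N by (intro sum.mono_neutral_right) (auto simp: int_choose_def)
  also have "\<dots> = (\<Sum>l\<le>N. (x gchoose l) * (of_nat t gchoose (N - l)))"
    by (intro sum.cong) (auto simp: int_choose_def N nat_diff_distrib)
  also have "\<dots> = (x + of_nat t) gchoose N"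
    using gbinomial_Vandermonde[of x "of_nat t" N] by (simp add: atLeast0AtMost)
  finally show ?thesis by (simp add: N)
qed

text \<open>Vandermonde twice. The inner sum is (r - 1 + t choose r + M), which upper negation turns
  into (-1)^(r + M) (M - t choose r + M). The outer sum is then again a convolution, equal up to
  sign to (k + M - t choose k + M), and this is 0 unless t = 0. In \<open>vop_vop_m1_skew\<close> it
  singles out the terms with t = 0.\<close>

lemma alternating_sum_gchoose_int_choose:
  assumes tk: "int t \<le> int k + M" and L: "int k + M \<le> int L"
  shows "(\<Sum>r\<le>k. of_nat (k choose r) * (-1) ^ r *
            (\<Sum>l\<le>L. (of_int (int r - 1) gchoose l) * int_choose t (int r + M - int l)))
       = (if t = 0 then (-1) powi M else 0)"
proof -
  \<comment> \<open>\<open>P\<close> is the value of s = r + M at r = k, and \<open>g\<close> is the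
    summand of the second convolution, indexed by s.\<close>
  define P where "P = nat (int k + M)"
  have P: "int P = int k + M" using tk by (simp add: P_def)
  define g where "g s = (of_int (M - int t) gchoose s) * ((of_nat k :: complex) gchoose (P - s))" for s
  have summand: "of_nat (k choose r) * (-1) ^ r *
            (\<Sum>l\<le>L. (of_int (int r - 1) gchoose l) * int_choose t (int r + M - int l))
          = (if int r + M < 0 then 0 else (-1) powi M * g (nat (int r + M)))"
    if "r \<le> k" for r
  proof (cases "int r + M < 0")
    case True
    have "int r + M \<le> int L" using that L by linarith
    with True show ?thesis by (simp add: sum_gchoose_int_choose)
  next
    case False
    then obtain N where N: "int r + M = int N" by (metis nonneg_int_cases not_less)
    have M: "M = int N - int r" using N by simp
    have PN: "P - N = k - r" "r \<le> k" using N P that by auto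
    have sgn: "(-1::complex) ^ r * (-1) ^ N = (-1) powi M"
      by (simp add: M power_int_diff power_int_minus field_simps flip: power_mult_distrib)
    have "((of_int (int r - 1) + of_nat t :: complex) gchoose N)
        = (-1) ^ N * (of_int (M - int t) gchoose N)"
      by (subst gbinomial_negated_upper) (simp add: M algebra_simps)
    moreover have "int r + M \<le> int L" using that L by linarith
    moreover have "(of_nat (k choose r) :: complex) = of_nat k gchoose (P - N)"
      by (metis PN binomial_gbinomial binomial_symmetric)
    ultimately show ?thesis using False sgn
      by (simp add: sum_gchoose_int_choose N g_def mult_ac)
  qed
  have "(\<Sum>r\<le>k. of_nat (k choose r) * (-1) ^ r *
            (\<Sum>l\<le>L. (of_int (int r - 1) gchoose l) * int_choose t (int r + M - int l)))
      = (\<Sum>r\<le>k. if int r + M < 0 then 0 else (-1) powi M * g (nat (int r + M)))"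
    by (intro sum.cong refl summand) simp
  also have "\<dots> = (\<Sum>r\<in>{r. r \<le> k \<and> 0 \<le> int r + M}. (-1) powi M * g (nat (int r + M)))"
    by (intro sum.mono_neutral_cong_right) auto
  also have "\<dots> = (\<Sum>s\<in>{s. s \<le> P \<and> M \<le> int s}. (-1) powi M * g s)"
    by (rule sum.reindex_bij_witness[where i = "\<lambda>s. nat (int s - M)" and j = "\<lambda>r. nat (int r + M)"])
      (use P in auto)
  also have "\<dots> = (\<Sum>s\<le>P. (-1) powi M * g s)"
  proof (intro sum.mono_neutral_left ballI)
    fix s assume "s \<in> {..P} - {s. s \<le> P \<and> M \<le> int s}"
    then have "k < P - s" using P by auto
    then have "(of_nat k :: complex) gchoose (P - s) = 0"
      by (metis binomial_eq_0 binomial_gbinomial of_nat_0)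
    then show "(-1) powi M * g s = 0" by (simp add: g_def)
  qed auto
  also have "\<dots> = (-1) powi M * ((of_int (M - int t) + of_nat k) gchoose P)"
    by (simp add: g_def gbinomial_Vandermonde atLeast0AtMost[symmetric] flip: sum_distrib_left)
  also have "(of_int (M - int t) + of_nat k :: complex) = of_nat (P - t)"
  proof -
    have "M - int t + int k = int (P - t)" using P tk by linarith
    then show ?thesis by (metis of_int_add of_int_of_nat_eq)
  qed
  also have "(of_nat (P - t) gchoose P :: complex) = (if t = 0 then 1 else 0)"
  proof (cases "t = 0")
    case False
    then have "P - t < P" using P tk by linarith
    then have "(P - t choose P) = 0" by (rule binomial_eq_0)
    then show ?thesis using False by (metis binomial_gbinomial of_nat_0)
  qed (simp flip: binomial_gbinomial)
  finally show ?thesis by simp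
qed

section \<open>Modes and weak associativity in a nonlocal vertex algebra\<close>

locale nonlocal_vertex_algebra =
  fixes K :: "('k::ab_group_add) nlva_data"
  assumes nlva: "nlva K"
begin

abbreviation scale (infixr "*s" 75) where "scale \<equiv> scal K"

sublocale vector_space "scal K" using nlva by (simp add: nlva_def)

lemma linear_vop_left: "Vector_Spaces.linear (scal K) (scal K) (\<lambda>v. vop K v n w)"
  and linear_vop_right: "Vector_Spaces.linear (scal K) (scal K) (vop K v n)"
  and vop_vac: "vop K (vac K) n v = (if n = -1 then v else 0)"
  and vop_creation: "n \<ge> 0 \<Longrightarrow> vop K v n (vac K) = 0"
  and vop_m1_vac [simp]: "vop K v (-1) (vac K) = v"
  using nlva by (auto simp: nlva_def)

lemma vop_truncated: "\<exists>N. \<forall>n\<ge>N. vop K v n w = 0"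
proof -
  obtain N where "\<forall>n. n > N \<longrightarrow> vop K v n w = 0" using nlva unfolding nlva_def by blast
  then show ?thesis by (intro exI[of _ "N + 1"]) auto
qed

lemma vop_truncated_finite:
  assumes "finite I"
  shows "\<exists>N. \<forall>i\<in>I. \<forall>n\<ge>N. vop K (v i) n w = 0"
  using assms
proof induction
  case (insert x F)
  then obtain N where "\<forall>i\<in>F. \<forall>n\<ge>N. vop K (v i) n w = 0" by blast
  moreover obtain N' where "\<forall>n\<ge>N'. vop K (v x) n w = 0" using vop_truncated by blast
  ultimately show ?case by (intro exI[of _ "max N N'"]) auto
qed simp

interpretation left: Vector_Spaces.linear "scal K" "scal K" "\<lambda>v. vop K v n w" for n w
  by (rule linear_vop_left)
interpretation right: Vector_Spaces.linear "scal K" "scal K" "vop K v n" for v n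
  by (rule linear_vop_right)

lemmas vop_add_left = left.add and vop_scale_left = left.scale
  and vop_zero_left [simp] = left.zero and vop_sum_left = left.sum
  and vop_add_right = right.add and vop_scale_right = right.scale
  and vop_zero_right [simp] = right.zero and vop_sum_right = right.sum

lemma mult_binom_coeff_0 [simp]: "mult_binom_coeff K 0 F a b = F a b"
  by (simp add: mult_binom_coeff_def)

text \<open>Pascal's rule; it lets inductions on the exponent multiply or cancel one factor x0 + x2
  at a time.\<close>

lemma mult_binom_coeff_Suc:
  "mult_binom_coeff K (Suc k) F a b
     = mult_binom_coeff K k F (a - 1) b + mult_binom_coeff K k F a (b - 1)"
proof -
  let ?G = "\<lambda>i. F (a - int i) (b - int (Suc k - i))"
  have "mult_binom_coeff K (Suc k) F a b
      = ?G 0 + (\<Sum>i\<le>k. of_nat (Suc k choose Suc i) *s ?G (Suc i))"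
    unfolding mult_binom_coeff_def by (subst sum.atMost_Suc_shift) simp
  also have "\<dots> = (\<Sum>i\<le>k. of_nat (k choose i) *s ?G (Suc i))
      + (?G 0 + (\<Sum>i\<le>k. of_nat (k choose Suc i) *s ?G (Suc i)))"
    by (simp add: scale_left_distrib sum.distrib)
  also have "?G 0 + (\<Sum>i\<le>k. of_nat (k choose Suc i) *s ?G (Suc i))
      = (\<Sum>i\<le>Suc k. of_nat (k choose i) *s ?G i)"
    using sum.atMost_Suc_shift[of "\<lambda>i. of_nat (k choose i) *s ?G i" k] by simp
  also have "\<dots> = mult_binom_coeff K k F a (b - 1)"
    unfolding mult_binom_coeff_def by (auto intro!: sum.cong simp: Suc_diff_le algebra_simps)
  also have "(\<Sum>i\<le>k. of_nat (k choose i) *s ?G (Suc i)) = mult_binom_coeff K k F (a - 1) b"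
    unfolding mult_binom_coeff_def by (auto intro!: sum.cong simp: algebra_simps)
  finally show ?thesis .
qed

lemma mult_binom_coeff_mono:
  assumes "\<forall>a b. mult_binom_coeff K k F a b = mult_binom_coeff K k G a b" and "k \<le> l"
  shows "mult_binom_coeff K l F a b = mult_binom_coeff K l G a b"
  using \<open>k \<le> l\<close> by (induction l arbitrary: a b rule: dec_induct)
    (simp_all add: assms mult_binom_coeff_Suc)

text \<open>On doubly infinite series x0 + x2 is a zero divisor: it kills the sum of (-1)^n x0^n
  x2^(-n-1) over all integers n. Agreement at negative powers of x0 excludes this, because with one
  factor removed the coefficient at (a, b) is determined by the one at (a - 1, b + 1).\<close>

lemma mult_binom_coeff_cancel_left:
  assumes "\<forall>a b. mult_binom_coeff K k F a b = mult_binom_coeff K k G a b"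
    and "\<And>a b. a < 0 \<Longrightarrow> F a b = G a b"
  shows "F a b = G a b"
  using assms(1)
proof (induction k arbitrary: a b)
  case (Suc k)
  let ?E = "mult_binom_coeff K k F" and ?E' = "mult_binom_coeff K k G"
  have neg: "?E a b = ?E' a b" if "a < 0" for a b
    unfolding mult_binom_coeff_def using that assms(2) by (auto intro!: sum.cong)
  \<comment> \<open>The shift by one starts the induction at a = -1, where \<open>neg\<close>
    applies.\<close>
  have "?E (int n - 1) b = ?E' (int n - 1) b" for n b
  proof (induction n arbitrary: b)
    case (Suc n)
    then show ?case
      using Suc.prems \<open>\<forall>a b. mult_binom_coeff K (Suc k) F a b = _ a b\<close>[rule_format, of "int n" "b + 1"]
      by (simp add: mult_binom_coeff_Suc)
  qed (simp add: neg)
  then have "?E a b = ?E' a b" for a b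
    using neg[of a b] by (cases "a < 0") (metis, metis add_diff_cancel_right' int_nat_eq add.commute add_nonneg_nonneg linorder_not_less zero_le_one)
  then show ?case by (intro Suc.IH) simp
qed simp

text \<open>Here the recursion runs upwards in the power of x2.\<close>

lemma mult_binom_coeff_cancel_right:
  assumes "\<forall>a b. mult_binom_coeff K k F a b = mult_binom_coeff K k G a b"
    and "\<And>a b. b < 0 \<Longrightarrow> F a b = G a b"
  shows "F a b = G a b"
  using assms(1)
proof (induction k arbitrary: a b)
  case (Suc k)
  let ?E = "mult_binom_coeff K k F" and ?E' = "mult_binom_coeff K k G"
  have neg: "?E a b = ?E' a b" if "b < 0" for a b
    unfolding mult_binom_coeff_def using that assms(2) by (auto intro!: sum.cong)
  have "?E a (int n - 1) = ?E' a (int n - 1)" for n a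
  proof (induction n arbitrary: a)
    case (Suc n)
    then show ?case
      using Suc.prems \<open>\<forall>a b. mult_binom_coeff K (Suc k) F a b = _ a b\<close>[rule_format, of "a + 1" "int n"]
      by (simp add: mult_binom_coeff_Suc)
  qed (simp add: neg)
  then have "?E a b = ?E' a b" for a b
    using neg[of b a] by (cases "b < 0") (metis, metis add_diff_cancel_right' int_nat_eq add.commute add_nonneg_nonneg linorder_not_less zero_le_one)
  then show ?case by (intro Suc.IH) simp
qed simp

lemma prod_coeff_eq_sum:
  assumes "\<And>m. m \<ge> Q \<Longrightarrow> vop K v m w = 0" and "Q + b + 1 \<le> int J"
  shows "prod_coeff K u v w a b = (\<Sum>j<J. (of_int (a + int j) gchoose j) *s
           vop K u (- a - 1 - int j) (vop K v (int j - b - 1) w))"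
proof -
  have "vop K v (int j - b - 1) w = 0" if "j \<ge> J" for j
    using that assms(2) by (intro assms(1)) linarith
  then show ?thesis
    unfolding prod_coeff_def by (intro Sum_any.expand_superset) (force simp: not_less[symmetric])+
qed

text \<open>Both sides are the coefficient of \<open>x0\<^sup>a x2\<^sup>b\<close> in \<open>x1\<^sup>k Y(u,x1) Y(v,x2) w\<close> at \<open>x1 = x0 + x2\<close>.\<close>
lemma mult_binom_coeff_prod_coeff:
  assumes trunc: "\<And>m. m \<ge> Q \<Longrightarrow> vop K v m w = 0" and "Q + b + 1 \<le> int J"
  shows "mult_binom_coeff K k (prod_coeff K u v w) a b = (\<Sum>j<J. (of_int (a + int j) gchoose j) *s
           vop K u (int k - a - 1 - int j) (vop K v (int j - b - 1) w))"
  using assms(2)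
proof (induction k arbitrary: a b)
  case 0
  then show ?case using trunc by (simp add: prod_coeff_eq_sum[OF trunc])
next
  case (Suc k)
  let ?W = "\<lambda>j. vop K u (int k - a - int j) (vop K v (int j - b - 1) w)"
  have WJ: "?W J = 0" using trunc Suc.prems by simp
  have "mult_binom_coeff K (Suc k) (prod_coeff K u v w) a b
      = (\<Sum>j<J. (of_int (a - 1 + int j) gchoose j) *s ?W j)
      + (\<Sum>j<J. (of_int (a + int j) gchoose j) *s ?W (Suc j))"
    using Suc by (simp add: mult_binom_coeff_Suc algebra_simps)
  \<comment> \<open>The added term j = J is 0 by truncation; after an index shift both sums run over
    the same vectors and Pascal's rule applies.\<close>
  also have "(\<Sum>j<J. (of_int (a - 1 + int j) gchoose j) *s ?W j)
     = (\<Sum>j<Suc J. (of_int (a - 1 + int j) gchoose j) *s ?W j)"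
    using WJ by simp
  also have "\<dots> = ?W 0 + (\<Sum>j<J. (of_int (a + int j) gchoose Suc j) *s ?W (Suc j))"
    by (subst sum.lessThan_Suc_shift) simp
  also have "\<dots> + (\<Sum>j<J. (of_int (a + int j) gchoose j) *s ?W (Suc j))
     = ?W 0 + (\<Sum>j<J. (of_int (a + int (Suc j)) gchoose Suc j) *s ?W (Suc j))"
  proof -
    have "((of_int (a + int (Suc j)) :: complex) gchoose Suc j)
        = (of_int (a + int j) gchoose j) + (of_int (a + int j) gchoose Suc j)" for j
      using gbinomial_Suc_Suc[of "of_int (a + int j) :: complex" j] by (simp add: algebra_simps)
    then show ?thesis by (simp add: scale_left_distrib sum.distrib add_ac)
  qed
  also have "\<dots> = (\<Sum>j<Suc J. (of_int (a + int j) gchoose j) *s ?W j)"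
    by (subst sum.lessThan_Suc_shift) simp
  also have "\<dots> = (\<Sum>j<J. (of_int (a + int j) gchoose j) *s ?W j)"
    using WJ by simp
  finally show ?case by (simp add: algebra_simps)
qed

text \<open>Any larger exponent works too, so \<open>k\<close> can be raised above other
  bounds.\<close>

lemma weak_associativity:
  "\<exists>k0. \<forall>k\<ge>k0. \<forall>a b. mult_binom_coeff K k (prod_coeff K u v w) a b
                    = mult_binom_coeff K k (iter_coeff K u v w) a b"
proof -
  obtain k0 where "\<forall>a b. mult_binom_coeff K k0 (prod_coeff K u v w) a b
                    = mult_binom_coeff K k0 (iter_coeff K u v w) a b"
    using nlva unfolding nlva_def by blast
  then show ?thesis using mult_binom_coeff_mono by blast
qed

text \<open>In generating series, Y(Du, x) = d/dx Y(u, x). It is the coefficient of x0 in weak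
  associativity for u, 1, w: by the creation property only the terms with Du and u remain on the
  iterate side.\<close>

lemma vop_Dop: "vop K (Dop K u) m w = - of_int m *s vop K u (m - 1) w"
proof -
  obtain k0 where k0: "\<forall>k\<ge>k0. \<forall>a b. mult_binom_coeff K k (prod_coeff K u (vac K) w) a b
                    = mult_binom_coeff K k (iter_coeff K u (vac K) w) a b"
    using weak_associativity by blast
  define k where "k = Suc (max k0 (nat m))"
  have k: "k \<ge> k0" "int k > m" "k > 0" by (auto simp: k_def)
  \<comment> \<open>With this power of x2 the term i = 0 of the iterate side is the mode m of Du; k
    > m makes it a natural number.\<close>
  define b where "b = nat (int k - 1 - m)"
  have b: "int b = int k - 1 - m" using k by (simp add: b_def)
  have "mult_binom_coeff K k (prod_coeff K u (vac K) w) 1 (int b)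
     = (\<Sum>j<Suc b. (of_int (1 + int j) gchoose j) *s
           vop K u (int k - 1 - 1 - int j) (vop K (vac K) (int j - int b - 1) w))"
    by (rule mult_binom_coeff_prod_coeff[where Q = 0]) (auto simp: vop_vac)
  also have "\<dots> = (\<Sum>j\<in>{b}. (of_int (1 + int j) gchoose j) *s
           vop K u (int k - 1 - 1 - int j) (vop K (vac K) (int j - int b - 1) w))"
    by (rule sum.mono_neutral_right) (auto simp: vop_vac)
  also have "\<dots> = of_int (1 + int b) *s vop K u (m - 1) w"
  proof -
    have "((of_int (1 + int b) :: complex) gchoose b) = of_int (1 + int b)"
      using binomial_gbinomial[of "Suc b" b, where ?'a = complex] by simp
    moreover have "int k - 1 - 1 - int b = m - 1" using b by simp
    ultimately show ?thesis
      by (simp only: sum.insert sum.empty finite.emptyI empty_iff not_False_eq_True) (simp add: vop_vac)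
  qed
  finally have 1: "mult_binom_coeff K k (prod_coeff K u (vac K) w) 1 (int b)
     = of_int (1 + int b) *s vop K u (m - 1) w" .
  have "mult_binom_coeff K k (iter_coeff K u (vac K) w) 1 (int b)
     = (\<Sum>i\<in>{0,1}. of_nat (k choose i) *s
          vop K (vop K u (int i - 2) (vac K)) (int (k - i) - int b - 1) w)"
    unfolding mult_binom_coeff_def iter_coeff_def
    using k by (intro sum.mono_neutral_cong_right) (auto simp: vop_creation algebra_simps)
  also have "\<dots> = vop K (Dop K u) m w + of_nat k *s vop K u (m - 1) w"
  proof -
    have "int (k - 0) - int b - 1 = m" "int (k - 1) - int b - 1 = m - 1" using k b by auto
    then have "(\<Sum>i\<in>{0, 1}. of_nat (k choose i) *s
          vop K (vop K u (int i - 2) (vac K)) (int (k - i) - int b - 1) w)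
        = of_nat (k choose 0) *s vop K (vop K u (int 0 - 2) (vac K)) m w
        + of_nat (k choose 1) *s vop K (vop K u (int 1 - 2) (vac K)) (m - 1) w"
      by (simp del: of_nat_diff)
    then show ?thesis by (simp add: Dop_def)
  qed
  finally have "vop K (Dop K u) m w = of_int (1 + int b) *s vop K u (m - 1) w
     - of_nat k *s vop K u (m - 1) w"
    using 1 k0 k by (metis add_diff_cancel_right')
  also have "\<dots> = of_int (1 + int b - int k) *s vop K u (m - 1) w"
    by (simp add: scale_left_diff_distrib)
  also have "of_int (1 + int b - int k) = (- of_int m :: complex)" using b by simp
  finally show ?thesis .
qed

text \<open>After division by l! this is Y(e^(xD) u, x2) = Y(u, x2 + x), which serves to expand the
  exponential in the skew symmetry.\<close>

lemma vop_Dop_power: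
  "vop K (((Dop K) ^^ l) u) m w = ((-1) ^ l * fact l * (of_int m gchoose l)) *s vop K u (m - int l) w"
proof (induction l arbitrary: m)
  case (Suc l)
  have "(of_int m :: complex) * (of_int (m - 1) gchoose l) = of_nat (Suc l) * (of_int m gchoose Suc l)"
    using gbinomial_absorption[of l "of_int m :: complex"] by simp
  then have "(-1) ^ Suc l * fact l * ((of_int m :: complex) * (of_int (m - 1) gchoose l))
     = (-1) ^ Suc l * fact l * (of_nat (Suc l) * (of_int m gchoose Suc l))"
    by simp
  then have "- (of_int m :: complex) * ((-1) ^ l * fact l * (of_int (m - 1) gchoose l))
     = (-1) ^ Suc l * fact (Suc l) * (of_int m gchoose Suc l)"
    by (simp add: mult_ac del: of_nat_Suc)
  moreover have "vop K ((Dop K ^^ Suc l) u) m w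
     = (- of_int m * ((-1) ^ l * fact l * (of_int (m - 1) gchoose l))) *s vop K u (m - int (Suc l)) w"
    unfolding funpow.simps o_apply vop_Dop Suc scale_scale by (simp add: algebra_simps)
  ultimately show ?case by (simp only:)
qed simp

text \<open>The hypotheses say that \<open>Y(u,x0)v\<close> and \<open>Y(u,x1)Y(v,x2)w\<close> have no poles in \<open>x0\<close> and \<open>x1\<close>,
  so the factor \<open>(x0 + x2)\<^sup>k\<close> can be cancelled in series with nonnegative powers of \<open>x0\<close>.\<close>
lemma iter_coeff_eq_prod_coeff:
  assumes uv: "\<And>n. n \<ge> 0 \<Longrightarrow> vop K u n v = 0"
    and uvw: "\<And>n m. n \<ge> 0 \<Longrightarrow> vop K u n (vop K v m w) = 0"
  shows "iter_coeff K u v w a b = prod_coeff K u v w a b"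
proof -
  obtain k where k: "\<forall>a b. mult_binom_coeff K k (prod_coeff K u v w) a b
                    = mult_binom_coeff K k (iter_coeff K u v w) a b"
    using weak_associativity by blast
  have "prod_coeff K u v w a b = iter_coeff K u v w a b"
  proof (rule mult_binom_coeff_cancel_left[OF k])
    fix a b :: int assume a: "a < 0"
    \<comment> \<open>If a + j < 0, the mode of \<open>u\<close> is nonnegative and
      \<open>uvw\<close> applies. Otherwise 0 <= a + j < j and the binomial coefficient
      vanishes.\<close>
    have zero: "(\<lambda>j. (of_int (a + int j) gchoose j) *s
              vop K u (- a - 1 - int j) (vop K v (int j - b - 1) w)) = (\<lambda>j. 0)"
    proof
      fix j
      show "(of_int (a + int j) gchoose j) *s
              vop K u (- a - 1 - int j) (vop K v (int j - b - 1) w) = 0"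
      using a gchoose_of_int_eq_0[of "a + int j" j] by (cases "a + int j < 0") (auto simp: uvw)
    qed
    show "prod_coeff K u v w a b = iter_coeff K u v w a b"
      using a by (simp only: prod_coeff_def zero) (simp add: iter_coeff_def uv)
  qed
  then show ?thesis by simp
qed

text \<open>\<open>iter_coeff_eq_prod_coeff\<close> with summation index t = s + j in place of j.
  The range up to \<open>T\<close> and the vectors u_(-1-t) no longer involve s, so sums over s can
  be carried out first, on binomial coefficients alone.\<close>

lemma vop_iter_eq_sum:
  assumes uv: "\<And>n. n \<ge> 0 \<Longrightarrow> vop K u n v = 0"
    and uvw: "\<And>n m. n \<ge> 0 \<Longrightarrow> vop K u n (vop K v m w) = 0"
    and T: "\<And>t. t > int T \<Longrightarrow> vop K v (m + t - s) w = 0"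
  shows "vop K (vop K u (- 1 - s) v) m w
       = (\<Sum>t\<le>T. int_choose t s *s vop K u (- 1 - int t) (vop K v (m + int t - s) w))"
proof (cases "s < 0")
  case True
  then show ?thesis by (simp add: uv int_choose_def)
next
  case False
  then obtain n where s: "s = int n" by (metis nonneg_int_cases not_less)
  let ?g = "\<lambda>t. int_choose t s *s vop K u (- 1 - int t) (vop K v (m + int t - s) w)"
  have "vop K (vop K u (- 1 - s) v) m w = prod_coeff K u v w s (- m - 1)"
    using iter_coeff_eq_prod_coeff[OF uv uvw, of s "- m - 1"] 
    unfolding iter_coeff_def by (simp add: uminus_add_conv_diff) (metis minus_diff_commute)
  also have "\<dots> = (\<Sum>j<Suc T. (of_int (s + int j) gchoose j) *s
           vop K u (- s - 1 - int j) (vop K v (int j - (- m - 1) - 1) w))"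
  proof (rule prod_coeff_eq_sum[where Q = "int T + 1 + m - s"])
    show "vop K v i w = 0" if "i \<ge> int T + 1 + m - s" for i
      using T[of "i - m + s"] that by (simp add: algebra_simps)
  qed (use False in auto)
  also have "\<dots> = (\<Sum>j<Suc T. ?g (n + j))"
  proof (intro sum.cong refl)
    fix j
    have "n + j choose j = (n + j choose n)" using binomial_symmetric[of j "n + j"] by simp
    then have "(of_int (s + int j) :: complex) gchoose j = int_choose (n + j) s"
      unfolding int_choose_def s using binomial_gbinomial[of "n + j" j, where ?'a = complex]
        binomial_gbinomial[of "n + j" n, where ?'a = complex] by simp
    moreover have "- s - 1 - int j = - 1 - int (n + j)"
      and "int j - (- m - 1) - 1 = m + int (n + j) - s"
      by (simp_all add: s)
    ultimately show "(of_int (s + int j) gchoose j) *s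
           vop K u (- s - 1 - int j) (vop K v (int j - (- m - 1) - 1) w) = ?g (n + j)"
      by (simp only:)
  qed
  also have "\<dots> = sum ?g {n..<n + Suc T}"
    by (simp add: sum.atLeastLessThan_shift_0[of _ n] lessThan_atLeast0)
  \<comment> \<open>Terms beyond \<open>T\<close> vanish by truncation; those below
    \<open>n\<close>, added next, vanish because (t choose n) = 0.\<close>
  also have "\<dots> = sum ?g ({n..<n + Suc T} \<inter> {..T})"
  proof (intro sum.mono_neutral_right ballI)
    fix t assume "t \<in> {n..<n + Suc T} - {n..<n + Suc T} \<inter> {..T}"
    then have "vop K v (m + int t - s) w = 0" by (intro T) auto
    then show "?g t = 0" by simp
  qed auto
  also have "\<dots> = sum ?g {..T}"
  proof (intro sum.mono_neutral_left ballI)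
    fix t assume "t \<in> {..T} - {n..<n + Suc T} \<inter> {..T}"
    then have "t < n" by auto
    then have "int_choose t s = 0" 
      unfolding int_choose_def s using binomial_gbinomial[of t n, where ?'a = complex]
      by (simp add: binomial_eq_0)
    then show "?g t = 0" by simp
  qed auto
  finally show ?thesis .
qed

text \<open>Here both sides of weak associativity have nonnegative powers of \<open>x2\<close>, and cancelling
  \<open>(x0 + x2)\<^sup>k\<close> and putting \<open>x2 = 0\<close> gives the claim.\<close>
lemma vop_m1_assoc:
  assumes vw: "\<And>n. n \<ge> 0 \<Longrightarrow> vop K v n w = 0"
    and uvw: "\<And>n m. n \<ge> 0 \<Longrightarrow> vop K (vop K u m v) n w = 0"
  shows "vop K u m (vop K v (-1) w) = vop K (vop K u m v) (-1) w"
proof -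
  obtain k where k: "\<forall>a b. mult_binom_coeff K k (prod_coeff K u v w) a b
                    = mult_binom_coeff K k (iter_coeff K u v w) a b"
    using weak_associativity by blast
  have "prod_coeff K u v w (- m - 1) 0 = iter_coeff K u v w (- m - 1) 0"
  proof (rule mult_binom_coeff_cancel_right[OF k])
    fix a b :: int assume b: "b < 0"
    then show "prod_coeff K u v w a b = iter_coeff K u v w a b"
      by (subst prod_coeff_eq_sum[where Q = 0 and J = 0]) (auto simp: iter_coeff_def vw uvw)
  qed
  moreover have "prod_coeff K u v w (- m - 1) 0 = vop K u m (vop K v (-1) w)"
    by (subst prod_coeff_eq_sum[where Q = 0 and J = 1]) (auto simp: vw)
  ultimately show ?thesis by (simp add: iter_coeff_def)
qed

section \<open>Modes of u_{-1}v, modes acting on v_{-1}w, and skew symmetry\<close>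

text \<open>Put x0 = 0 in weak associativity: as Y(u, x0)v is regular, the iterate side becomes x2^k
  Y(u_{-1}v, x2)w. The product Y(u, x1)Y(v, x2)w may have poles in x1, so the factor x1^k stays and
  the sum is that of u_p v_(n-1-p) w over p < k only.\<close>

lemma vop_vop_m1_eq_sum:
  assumes uv: "\<And>n. n \<ge> 0 \<Longrightarrow> vop K u n v = 0"
  shows "\<exists>k0. \<forall>k\<ge>k0. \<forall>n J. (\<forall>m\<ge>n + int J - int k. vop K v m w = 0) \<longrightarrow>
     vop K (vop K u (-1) v) n w
       = (\<Sum>j<J. vop K u (int k - 1 - int j) (vop K v (n + int j - int k) w))"
proof -
  obtain k0 where k0: "\<forall>k\<ge>k0. \<forall>a b. mult_binom_coeff K k (prod_coeff K u v w) a b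
                    = mult_binom_coeff K k (iter_coeff K u v w) a b"
    using weak_associativity by blast
  show ?thesis
  proof (intro exI[of _ k0] allI impI)
    fix k J :: nat and n :: int
    assume k: "k0 \<le> k" and J: "\<forall>m\<ge>n + int J - int k. vop K v m w = 0"
    have "mult_binom_coeff K k (prod_coeff K u v w) 0 (int k - 1 - n)
      = (\<Sum>j<J. (of_int (0 + int j) gchoose j) *s
           vop K u (int k - 0 - 1 - int j) (vop K v (int j - (int k - 1 - n) - 1) w))"
      by (rule mult_binom_coeff_prod_coeff[where Q = "n + int J - int k"]) (use J in auto)
    also have "\<dots> = (\<Sum>j<J. vop K u (int k - 1 - int j) (vop K v (n + int j - int k) w))"
    proof (intro sum.cong refl)
      fix j
      have "(of_nat j gchoose j :: complex) = 1" by (metis binomial_gbinomial binomial_n_n of_nat_1)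
      then show "(of_int (0 + int j) gchoose j) *s
           vop K u (int k - 0 - 1 - int j) (vop K v (int j - (int k - 1 - n) - 1) w)
         = vop K u (int k - 1 - int j) (vop K v (n + int j - int k) w)"
        by (simp add: algebra_simps)
    qed
    also have "mult_binom_coeff K k (prod_coeff K u v w) 0 (int k - 1 - n)
       = mult_binom_coeff K k (iter_coeff K u v w) 0 (int k - 1 - n)"
      using k0 k by blast
    also have "\<dots> = (\<Sum>i\<in>{0}. of_nat (k choose i) *s
          vop K (vop K u (int i - 1) v) (int (k - i) - int k + n) w)"
      unfolding mult_binom_coeff_def iter_coeff_def
      by (intro sum.mono_neutral_cong_right) (auto simp: uv algebra_simps)
    finally show "vop K (vop K u (-1) v) n w
       = (\<Sum>j<J. vop K u (int k - 1 - int j) (vop K v (n + int j - int k) w))"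
      by simp
  qed
qed

text \<open>Put x2 = 0 in weak associativity: as Y(v, x2)w is regular, the product side is x0^k Y(u,
  x0) v_{-1}w. The exponent does not depend on n.\<close>

lemma vop_vop_m1_eq_sum_iter:
  assumes vw: "\<And>n. n \<ge> 0 \<Longrightarrow> vop K v n w = 0"
  shows "\<exists>k0. \<forall>k\<ge>k0. \<forall>n. vop K u n (vop K v (-1) w)
           = (\<Sum>r\<le>k. of_nat (k choose r) *s vop K (vop K u (n - int r) v) (int r - 1) w)"
proof -
  obtain k0 where k0: "\<forall>k\<ge>k0. \<forall>a b. mult_binom_coeff K k (prod_coeff K u v w) a b
                    = mult_binom_coeff K k (iter_coeff K u v w) a b"
    using weak_associativity by blast
  show ?thesis
  proof (intro exI[of _ k0] allI impI)
    fix k :: nat and n :: int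
    assume k: "k0 \<le> k"
    have "vop K u n (vop K v (-1) w)
        = mult_binom_coeff K k (prod_coeff K u v w) (int k - 1 - n) 0"
      by (subst mult_binom_coeff_prod_coeff[where Q = 0 and J = 1]) (auto simp: vw)
    also have "\<dots> = mult_binom_coeff K k (iter_coeff K u v w) (int k - 1 - n) 0"
      using k0 k by blast
    also have "\<dots> = (\<Sum>r\<le>k. of_nat (k choose r) *s vop K (vop K u (n - int r) v) (int r - 1) w)"
      unfolding mult_binom_coeff_def iter_coeff_def
    \<comment> \<open>The summation is reversed, so that \<open>r\<close> counts the factors x2
      taken from (x0 + x2)^k.\<close>
    proof (subst sum.nat_diff_reindex[symmetric, of _ "Suc k", unfolded lessThan_Suc_atMost], intro sum.cong refl)
      fix r assume "r \<in> {..k}"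
      then have r: "r \<le> k" by simp
      have "k - (Suc k - Suc r) = r" "Suc k - Suc r = k - r" "k choose (k - r) = (k choose r)"
        using r by (auto simp: binomial_symmetric[symmetric])
      then show "of_nat (k choose (Suc k - Suc r)) *s
           vop K (vop K u (- (int k - 1 - n - int (Suc k - Suc r)) - 1) v)
             (- (0 - int (k - (Suc k - Suc r))) - 1) w
         = of_nat (k choose r) *s vop K (vop K u (n - int r) v) (int r - 1) w"
        using r by (simp add: of_nat_diff algebra_simps)
    qed
    finally show "vop K u n (vop K v (-1) w)
           = (\<Sum>r\<le>k. of_nat (k choose r) *s vop K (vop K u (n - int r) v) (int r - 1) w)" .
  qed
qed

text \<open>In generating series: \<open>Y(u,x1) Y(v,x2) w = \<Sum> f_i(-x1 + x2) Y(a_i,x2) Y(c_i,x1) w\<close> at \<open>x2 = 0\<close>.\<close>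
lemma vop_vop_m1_skew:
  assumes vw: "\<And>n. n \<ge> 0 \<Longrightarrow> vop K v n w = 0"
    and ac: "\<And>i n. i < r \<Longrightarrow> n \<ge> 0 \<Longrightarrow> vop K (a i) n (c i) = 0"
    and acw: "\<And>i n m. i < r \<Longrightarrow> n \<ge> 0 \<Longrightarrow> vop K (a i) n (vop K (c i) m w) = 0"
    and skew: "\<And>n. vop K u n v = exp_D_coeff K (skew_series K id id r a c f) n"
    and f: "\<And>i k. i < r \<Longrightarrow> k < C \<Longrightarrow> f i k = 0"
    and cw: "\<And>i n. i < r \<Longrightarrow> n \<ge> Q \<Longrightarrow> vop K (c i) n w = 0"
    and E: "Q - n \<le> E"
  shows "vop K u n (vop K v (-1) w)
       = (\<Sum>i<r. \<Sum>k\<in>{C..<E}. (f i k * (-1) powi k) *s vop K (a i) (-1) (vop K (c i) (n + k) w))"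
proof -
  define S where "S = skew_series K id id r a c f"
  define e where "e i k t = vop K (a i) (-1 - int t) (vop K (c i) (n + k + int t) w)" for i k t
  obtain p0 where p0: "\<forall>p\<ge>p0. \<forall>n. vop K u n (vop K v (-1) w)
           = (\<Sum>q\<le>p. of_nat (p choose q) *s vop K (vop K u (n - int q) v) (int q - 1) w)"
    using vop_vop_m1_eq_sum_iter[of v w u, OF vw] by blast
  \<comment> \<open>p >= Q makes all terms outside the range of the binomial identity
    vanish.\<close>
  define p where "p = max p0 (nat Q)"
  have p: "p \<ge> p0" "int p \<ge> Q" by (auto simp: p_def)
  \<comment> \<open>For q <= p only powers m <= \<open>B\<close> of the skew series occur; for l >
    \<open>L\<close> the power falls below \<open>C\<close>, where the series is 0; for t >
    \<open>T\<close> the mode n + k + t is at least \<open>Q\<close>.\<close>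
  define B where "B = int p - n - 1"
  define L where "L = nat (B - C)"
  define T where "T = nat (Q - n - C)"
  have S_eq: "S m = (\<Sum>i<r. \<Sum>k\<in>{C..B}. (f i k * (-1) powi m) *s vop K (a i) (k - m - 1) (c i))"
    if "m \<le> B" for m
    unfolding S_def skew_series_def
  proof (intro sum.cong refl)
    fix i assume "i \<in> {..<r}"
    then have i: "i < r" by simp
    have "k \<in> {C..B}" if "(f i k * (-1) powi m) *s vop K (a i) (k - m - 1) (c i) \<noteq> 0" for k
      using f[OF i, of k] ac[OF i, of "k - m - 1"] that \<open>m \<le> B\<close> by fastforce
    then show "Sum_any (\<lambda>k. (f i k * (-1) powi m) *s vop K (id (a i)) (k - m - 1) (id (c i)))
       = (\<Sum>k\<in>{C..B}. (f i k * (-1) powi m) *s vop K (a i) (k - m - 1) (c i))"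
      unfolding id_apply by (intro Sum_any.expand_superset) auto
  qed
  have S_0: "S m = 0" if "m < C" for m
    unfolding S_def skew_series_def
  proof (intro sum.neutral ballI)
    fix i assume "i \<in> {..<r}"
    then have i: "i < r" by simp
    have "(\<lambda>k. (f i k * (-1) powi m) *s vop K (id (a i)) (k - m - 1) (id (c i))) = (\<lambda>k. 0)"
    proof
      fix k
      show "(f i k * (-1) powi m) *s vop K (id (a i)) (k - m - 1) (id (c i)) = 0"
        using f[OF i, of k] ac[OF i, of "k - m - 1"] that by (cases "k < C") auto
    qed
    then show "Sum_any (\<lambda>k. (f i k * (-1) powi m) *s vop K (id (a i)) (k - m - 1) (id (c i))) = 0"
      by (simp only: Sum_any.neutral)
  qed
  have Dop_power_0: "(Dop K ^^ l) 0 = 0" for l by (induction l) (auto simp: Dop_def)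
  \<comment> \<open>Skew symmetry, the expansion of e^(xD) and \<open>vop_iter_eq_sum\<close> in
    turn. No range depends on q and \<open>e\<close> contains neither q nor l, so these two sums act
    on scalars only.\<close>
  have iter: "vop K (vop K u (n - int q) v) (int q - 1) w
      = (\<Sum>l\<le>L. \<Sum>i<r. \<Sum>k\<in>{C..B}. \<Sum>t\<le>T.
           (((-1) ^ l * (of_int (int q - 1) gchoose l)) *
            (f i k * (-1) powi (int q - n - 1 - int l)) *
            int_choose t (int q + (- n - 1 - k) - int l)) *s e i k t)" if q: "q \<le> p" for q
  proof -
    let ?m = "\<lambda>l. int q - n - 1 - int l"
    have "vop K u (n - int q) v = (\<Sum>l\<le>L. (1 / of_nat (fact l)) *s (Dop K ^^ l) (S (?m l)))"
    proof -
      have eq: "- (n - int q) - 1 - int l = ?m l" for l by simp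
      have "l \<le> L" if "(1 / of_nat (fact l)) *s (Dop K ^^ l) (S (?m l)) \<noteq> 0" for l
      proof (rule ccontr)
        assume "\<not> l \<le> L"
        then have "?m l < C" using q by (simp add: L_def B_def)
        then show False using that by (simp add: S_0 Dop_power_0)
      qed
      then show ?thesis
        unfolding skew exp_D_coeff_def S_def[symmetric] eq
        by (intro Sum_any.expand_superset) auto
    qed
    then have "vop K (vop K u (n - int q) v) (int q - 1) w
      = (\<Sum>l\<le>L. ((-1) ^ l * (of_int (int q - 1) gchoose l)) *s vop K (S (?m l)) (int q - 1 - int l) w)"
      by (simp add: vop_sum_left vop_scale_left vop_Dop_power)
    also have "\<dots> = (\<Sum>l\<le>L. ((-1) ^ l * (of_int (int q - 1) gchoose l)) *s
        (\<Sum>i<r. \<Sum>k\<in>{C..B}. (f i k * (-1) powi ?m l) *s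
           (\<Sum>t\<le>T. int_choose t (int q + (- n - 1 - k) - int l) *s e i k t)))"
    proof (intro sum.cong refl arg_cong2[where f = scale])
      fix l
      have "vop K (S (?m l)) (int q - 1 - int l) w = (\<Sum>i<r. \<Sum>k\<in>{C..B}. (f i k * (-1) powi ?m l) *s
           vop K (vop K (a i) (k - ?m l - 1) (c i)) (int q - 1 - int l) w)"
        using q by (subst S_eq) (simp_all add: B_def vop_sum_left vop_scale_left)
      also have "\<dots> = (\<Sum>i<r. \<Sum>k\<in>{C..B}. (f i k * (-1) powi ?m l) *s
           (\<Sum>t\<le>T. int_choose t (int q + (- n - 1 - k) - int l) *s e i k t))"
      proof (intro sum.cong refl arg_cong2[where f = scale])
        fix i k assume "i \<in> {..<r}" "k \<in> {C..B}"
        then have i: "i < r" and k: "C \<le> k" by auto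
        let ?s = "int q + (- n - 1 - k) - int l"
        have s1: "k - ?m l - 1 = - 1 - ?s" by simp
        have s2: "int q - 1 - int l + t - ?s = n + k + t" for t by simp
        have "vop K (c i) (n + k + t) w = 0" if "t > int T" for t
          using that k by (intro cw[OF i]) (auto simp: T_def split: if_splits)
        then show "vop K (vop K (a i) (k - ?m l - 1) (c i)) (int q - 1 - int l) w
           = (\<Sum>t\<le>T. int_choose t ?s *s e i k t)"
          unfolding s1 e_def
          by (subst vop_iter_eq_sum[where T = T]) (simp_all only: s2 ac[OF i] acw[OF i])
      qed
      finally show "vop K (S (?m l)) (int q - 1 - int l) w = (\<Sum>i<r. \<Sum>k\<in>{C..B}. (f i k * (-1) powi ?m l) *s
           (\<Sum>t\<le>T. int_choose t (int q + (- n - 1 - k) - int l) *s e i k t))" .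
    qed
    finally show ?thesis by (simp only: scale_sum_right scale_scale mult.assoc)
  qed
  let ?co = "\<lambda>i k t q l. of_nat (p choose q) * (((-1) ^ l * (of_int (int q - 1) gchoose l)) *
            (f i k * (-1) powi (int q - n - 1 - int l)) *
            int_choose t (int q + (- n - 1 - k) - int l))"
  \<comment> \<open>The alternating binomial identity with M = - n - 1 - k; where its condition on t
    fails, \<open>e i k t\<close> itself is 0.\<close>
  have coeff: "(\<Sum>q\<le>p. \<Sum>l\<le>L. ?co i k t q l) *s e i k t
             = (if t = 0 then (f i k * (-1) powi k) *s e i k 0 else 0)"
    if "i < r" "C \<le> k" for i k t
  proof (cases "int t \<le> int p + (- n - 1 - k)")
    case False
    then have "n + k + int t \<ge> Q" using p by simp
    then have "e i k t = 0" unfolding e_def by (simp add: cw[OF \<open>i < r\<close>])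
    then show ?thesis by auto
  next
    case True
    have sgn: "(-1::complex) ^ l * (-1) powi (int q - n - 1 - int l) = (-1) ^ q * (-1) powi (- n - 1)"
      for l q by (auto simp: power_int_minus_left minus_one_power_iff)
    have "?co i k t q l = (f i k * (-1) powi (- n - 1)) * (of_nat (p choose q) * (-1) ^ q *
            ((of_int (int q - 1) gchoose l) * int_choose t (int q + (- n - 1 - k) - int l)))" for q l
    proof -
      let ?x = "f i k * of_nat (p choose q) * (of_int (int q - 1) gchoose l) *
            int_choose t (int q + (- n - 1 - k) - int l)"
      have "?co i k t q l = ?x * ((-1) ^ l * (-1) powi (int q - n - 1 - int l))"
        by (simp only: mult_ac)
      also have "\<dots> = ?x * ((-1) ^ q * (-1) powi (- n - 1))" by (simp only: sgn)
      finally show ?thesis by (simp only: mult_ac)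
    qed
    then have "(\<Sum>q\<le>p. \<Sum>l\<le>L. ?co i k t q l) = (f i k * (-1) powi (- n - 1)) *
        (\<Sum>q\<le>p. of_nat (p choose q) * (-1) ^ q *
            (\<Sum>l\<le>L. (of_int (int q - 1) gchoose l) * int_choose t (int q + (- n - 1 - k) - int l)))"
      by (simp only: sum_distrib_left)
    also have "\<dots> = (f i k * (-1) powi (- n - 1)) * (if t = 0 then (-1) powi (- n - 1 - k) else 0)"
      using True that by (subst alternating_sum_gchoose_int_choose) (auto simp: L_def B_def)
    also have "\<dots> = (if t = 0 then f i k * (-1) powi k else 0)"
      by (auto simp: power_int_minus_left)
    finally show ?thesis by simp
  qed
  have "vop K u n (vop K v (-1) w)
      = (\<Sum>q\<le>p. \<Sum>l\<le>L. \<Sum>i<r. \<Sum>k\<in>{C..B}. \<Sum>t\<le>T. ?co i k t q l *s e i k t)"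
    using p0 p(1) by (auto simp: iter scale_sum_right intro!: sum.cong)
  also have "\<dots> = (\<Sum>q\<le>p. \<Sum>i<r. \<Sum>k\<in>{C..B}. \<Sum>t\<le>T. \<Sum>l\<le>L. ?co i k t q l *s e i k t)"
    by (simp only: sum.swap[where A = "{..L}"])
  also have "\<dots> = (\<Sum>i<r. \<Sum>k\<in>{C..B}. \<Sum>t\<le>T. \<Sum>q\<le>p. \<Sum>l\<le>L. ?co i k t q l *s e i k t)"
    by (simp only: sum.swap[where A = "{..p}"])
  also have "\<dots> = (\<Sum>i<r. \<Sum>k\<in>{C..B}. \<Sum>t\<le>T. if t = 0 then (f i k * (-1) powi k) *s e i k 0 else 0)"
  proof (intro sum.cong refl)
    fix i k t assume "i \<in> {..<r}" "k \<in> {C..B}"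
    then show "(\<Sum>q\<le>p. \<Sum>l\<le>L. ?co i k t q l *s e i k t)
             = (if t = 0 then (f i k * (-1) powi k) *s e i k 0 else 0)"
      unfolding scale_sum_left[symmetric] by (intro coeff) auto
  qed
  also have "\<dots> = (\<Sum>i<r. \<Sum>k\<in>{C..B}. (f i k * (-1) powi k) *s e i k 0)"
    by simp
  \<comment> \<open>The two ranges differ only in indices k >= Q - n, where (c_i)_(n+k) w =
    0.\<close>
  also have "\<dots> = (\<Sum>i<r. \<Sum>k\<in>{C..<E}. (f i k * (-1) powi k) *s vop K (a i) (-1) (vop K (c i) (n + k) w))"
  proof (intro sum.cong[of "{..<r}"] refl)
    fix i assume "i \<in> {..<r}"
    then have "vop K (c i) (n + k) w = 0" if "k \<ge> Q - n" for k using that by (intro cw) auto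
    then show "(\<Sum>k\<in>{C..B}. (f i k * (-1) powi k) *s e i k 0)
      = (\<Sum>k\<in>{C..<E}. (f i k * (-1) powi k) *s vop K (a i) (-1) (vop K (c i) (n + k) w))"
      using E p(2) by (intro sum.mono_neutral_cong) (auto simp: e_def B_def)
  qed
  finally show ?thesis .
qed

text \<open>Multiplicativity on elementary tensors, stated inside \<open>K\<close>: the modes of
  \<open>z\<close> are applied to \<open>vop_vop_m1_skew\<close> and moved onto a_i by
  \<open>vop_m1_assoc\<close>. \<open>S\<close> may be any finite set containing all relevant
  indices, so that the result matches an expansion of \<open>YR\<close> over the same set.\<close>

lemma vop_m1_vop_m1_skew:
  assumes vw: "\<And>n. n \<ge> 0 \<Longrightarrow> vop K v n w = 0"
    and ac: "\<And>i n. i < r \<Longrightarrow> n \<ge> 0 \<Longrightarrow> vop K (a i) n (c i) = 0"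
    and acw: "\<And>i n m. i < r \<Longrightarrow> n \<ge> 0 \<Longrightarrow> vop K (a i) n (vop K (c i) m w) = 0"
    and skew: "\<And>n. vop K u n v = exp_D_coeff K (skew_series K id id r a c f) n"
    and f: "\<And>i k. i < r \<Longrightarrow> k < C \<Longrightarrow> f i k = 0"
    and cw: "\<And>i n. i < r \<Longrightarrow> n \<ge> Q \<Longrightarrow> vop K (c i) n w = 0"
    and zu: "\<And>n. n \<ge> 0 \<Longrightarrow> vop K z n u = 0"
    and zacw: "\<And>i l n m. i < r \<Longrightarrow> n \<ge> 0 \<Longrightarrow> vop K (vop K z l (a i)) n (vop K (c i) m w) = 0"
    and za: "\<And>i n. i < r \<Longrightarrow> n \<ge> P \<Longrightarrow> vop K z n (a i) = 0"
    and S: "finite S" "\<And>k p. C \<le> k \<Longrightarrow> p < P \<Longrightarrow> n + k - 1 - p < Q \<Longrightarrow> (k, p) \<in> S"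
  shows "vop K (vop K z (-1) u) n (vop K v (-1) w)
       = (\<Sum>i<r. \<Sum>(k, p)\<in>S. (f i k * (-1) powi k) *s
            vop K (vop K z p (a i)) (-1) (vop K (c i) (n + k - 1 - p) w))"
proof -
  let ?g = "\<lambda>i k p. (f i k * (-1) powi k) *s
            vop K (vop K z p (a i)) (-1) (vop K (c i) (n + k - 1 - p) w)"
  obtain k0 where k0: "\<forall>k\<ge>k0. \<forall>n J. (\<forall>m\<ge>n + int J - int k. vop K u m (vop K v (-1) w) = 0) \<longrightarrow>
     vop K (vop K z (-1) u) n (vop K v (-1) w)
       = (\<Sum>j<J. vop K z (int k - 1 - int j) (vop K u (n + int j - int k) (vop K v (-1) w)))"
    using vop_vop_m1_eq_sum[of z u "vop K v (-1) w", OF zu] by blast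
  obtain N where N: "\<forall>m\<ge>N. vop K u m (vop K v (-1) w) = 0"
    using vop_truncated by blast
  \<comment> \<open>The sum over modes p of \<open>z\<close> is cut off at p < q; since q >= P, no
    nonzero z_p a_i is lost.\<close>
  define q where "q = max k0 (nat P)"
  have q: "q \<ge> k0" "int q \<ge> P" by (auto simp: q_def)
  \<comment> \<open>The first bound is the truncation required by \<open>k0\<close>; by the second,
    modes p < q - J contribute nothing. \<open>E\<close> below suits every j at once.\<close>
  define J where "J = nat (max (N - n + int q) (Q - n - C + int q))"
  have J: "int J \<ge> N - n + int q" "int J \<ge> Q - n - C + int q" by (auto simp: J_def)
  define E where "E = Q - n + int q"
  have "vop K (vop K z (-1) u) n (vop K v (-1) w)
      = (\<Sum>j<J. vop K z (int q - 1 - int j) (vop K u (n + int j - int q) (vop K v (-1) w)))"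
    using k0 q(1) N J(1) by auto
  also have "\<dots> = (\<Sum>j<J. \<Sum>i<r. \<Sum>k\<in>{C..<E}. ?g i k (int q - 1 - int j))"
  proof (intro sum.cong refl)
    fix j
    have "vop K u (n + int j - int q) (vop K v (-1) w)
        = (\<Sum>i<r. \<Sum>k\<in>{C..<E}. (f i k * (-1) powi k) *s
            vop K (a i) (-1) (vop K (c i) (n + int j - int q + k) w))"
      using vw ac acw skew f cw by (rule vop_vop_m1_skew) (auto simp: E_def)
    moreover have "vop K z (int q - 1 - int j) (vop K (a i) (-1) (vop K (c i) m w))
        = vop K (vop K z (int q - 1 - int j) (a i)) (-1) (vop K (c i) m w)" if "i < r" for i m
      using that by (intro vop_m1_assoc acw zacw)
    moreover have "n + int j - int q + k = n + k - 1 - (int q - 1 - int j)" for k by simp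
    ultimately show "vop K z (int q - 1 - int j) (vop K u (n + int j - int q) (vop K v (-1) w))
        = (\<Sum>i<r. \<Sum>k\<in>{C..<E}. ?g i k (int q - 1 - int j))"
      by (simp only: vop_sum_right vop_scale_right) simp
  qed
  also have "\<dots> = (\<Sum>i<r. \<Sum>k\<in>{C..<E}. \<Sum>j<J. ?g i k (int q - 1 - int j))"
    by (simp only: sum.swap[where A = "{..<J}"])
  also have "\<dots> = (\<Sum>i<r. \<Sum>k\<in>{C..<E}. \<Sum>p\<in>{int q - int J..<int q}. ?g i k p)"
    by (intro sum.cong refl sum.reindex_bij_witness[where i = "\<lambda>p. nat (int q - 1 - p)"
        and j = "\<lambda>j. int q - 1 - int j"]) auto
  also have "\<dots> = (\<Sum>i<r. \<Sum>(k, p)\<in>{C..<E} \<times> {int q - int J..<int q}. ?g i k p)"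
    by (simp add: sum.cartesian_product)
  also have "\<dots> = (\<Sum>i<r. \<Sum>(k, p)\<in>S. ?g i k p)"
  proof (intro sum.cong[of "{..<r}"] refl)
    fix i assume "i \<in> {..<r}"
    then have i: "i < r" by simp
    have zero: "?g i k p = 0" if "k < C \<or> p \<ge> P \<or> n + k - 1 - p \<ge> Q" for k p
      using that by (auto simp: f[OF i] za[OF i] cw[OF i])
    show "(\<Sum>(k, p)\<in>{C..<E} \<times> {int q - int J..<int q}. ?g i k p) = (\<Sum>(k, p)\<in>S. ?g i k p)"
    proof (intro sum.mono_neutral_cong ballI)
      fix x assume x: "x \<in> S - {C..<E} \<times> {int q - int J..<int q}"
      obtain k p where kp: "x = (k, p)" by (cases x)
      have "?g i k p = 0"
        by (rule zero) (use x J q in \<open>auto simp: kp E_def\<close>)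
      then show "(case x of (k, p) \<Rightarrow> ?g i k p) = 0" by (simp add: kp)
    next
      fix x assume x: "x \<in> {C..<E} \<times> {int q - int J..<int q} - S"
      obtain k p where kp: "x = (k, p)" by (cases x)
      have "k < C \<or> p \<ge> P \<or> n + k - 1 - p \<ge> Q"
        using x S(2)[of k p] unfolding kp by (meson DiffE not_le)
      then have "?g i k p = 0" by (rule zero)
      then show "(case x of (k, p) \<Rightarrow> ?g i k p) = 0" by (simp add: kp)
    qed (use S(1) in auto)
  qed
  finally show ?thesis .
qed

end

section \<open>Linear functionals and the tensor product\<close>

lemma linear_functional_iff:
  assumes "vector_space s"
  shows "Vector_Spaces.linear s (times :: complex \<Rightarrow> _) f
    \<longleftrightarrow> (\<forall>a b. f (a + b) = f a + f b) \<and> (\<forall>c a. f (s c a) = c * f a)"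
proof -
  interpret A: vector_space s by fact
  interpret B: vector_space "times :: complex \<Rightarrow> _" by unfold_locales (auto simp: algebra_simps)
  show ?thesis
    by (auto simp: Vector_Spaces.linear_def module_hom_def module_hom_axioms_def
        A.vector_space_axioms B.vector_space_axioms A.module_axioms B.module_axioms)
qed

text \<open>A nonzero difference is linearly independent, so some functional takes the value 1 on
  it.\<close>

lemma eq_if_linear_functionals_eq:
  assumes "vector_space s"
    and eq: "\<And>f. Vector_Spaces.linear s (times :: complex \<Rightarrow> _) f \<Longrightarrow> f x = f y"
  shows "x = y"
proof (rule ccontr)
  interpret A: vector_space s by fact
  interpret B: vector_space "times :: complex \<Rightarrow> _" by unfold_locales (auto simp: algebra_simps)
  interpret vector_space_pair s "times :: complex \<Rightarrow> _" ..
  assume "x \<noteq> y"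
  then have "A.independent {x - y}" by simp
  then obtain g where g: "Vector_Spaces.linear s (times :: complex \<Rightarrow> _) g" "g (x - y) = 1"
    using linear_independent_extend[of "{x - y}" "\<lambda>_. 1"] by auto
  have "g (x - y) = g x - g y" by (rule linear_diff[OF g(1)])
  then show False using eq[OF g(1)] g(2) by simp
qed

locale tensor_product = U: nonlocal_vertex_algebra U + V: nonlocal_vertex_algebra V
  for U :: "('u::ab_group_add) nlva_data" and V :: "('v::ab_group_add) nlva_data"
begin

lemma bilin_iff: "bilin U V B \<longleftrightarrow>
    (\<forall>u u' v. B (u + u') v = B u v + B u' v) \<and> (\<forall>c u v. B (scal U c u) v = c * B u v) \<and>
    (\<forall>u v v'. B u (v + v') = B u v + B u v') \<and> (\<forall>c u v. B u (scal V c v) = c * B u v)"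
  unfolding bilin_def linear_functional_iff[OF U.vector_space_axioms]
    linear_functional_iff[OF V.vector_space_axioms] by blast

lemma bilin_add: "bilin U V B \<Longrightarrow> bilin U V B' \<Longrightarrow> bilin U V (\<lambda>u v. B u v + B' u v)"
  and bilin_scale: "bilin U V B \<Longrightarrow> bilin U V (\<lambda>u v. c * B u v)"
  by (auto simp: bilin_iff algebra_simps)

lemma tens_add_left: "tens U V (u + u') v = tadd (tens U V u v) (tens U V u' v)"
  and tens_add_right: "tens U V u (v + v') = tadd (tens U V u v) (tens U V u v')"
  and tens_scale_left: "tens U V (scal U c u) v = tscale c (tens U V u v)"
  and tens_scale_right: "tens U V u (scal V c v) = tscale c (tens U V u v)"
  by (auto simp: tens_def tadd_def tscale_def bilin_iff fun_eq_iff)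

lemma zero_in_tspace: "(\<lambda>B. 0) \<in> tspace U V"
  unfolding tspace_def by (auto intro: exI[of _ "0::nat"])

lemma tadd_tens_in_tspace:
  assumes "t \<in> tspace U V"
  shows "tadd t (tens U V u v) \<in> tspace U V"
proof -
  obtain r us vs where t: "t = (\<lambda>B. \<Sum>i<(r::nat). tens U V (us i) (vs i) B)"
    using assms by (auto simp: tspace_def)
  have "tadd t (tens U V u v)
      = (\<lambda>B. \<Sum>i<Suc r. tens U V ((us(r := u)) i) ((vs(r := v)) i) B)"
    by (auto simp: t tadd_def fun_eq_iff intro!: sum.cong)
  then show ?thesis unfolding tspace_def by blast
qed

text \<open>Induction on the number of elementary tensors; scalars need no case of their own, since
  they can be absorbed into a factor.\<close>

lemma tspace_induct [consumes 1, case_names zero tadd]: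
  assumes "t \<in> tspace U V"
    and "P (\<lambda>B. 0)" and step: "\<And>s u v. s \<in> tspace U V \<Longrightarrow> P s \<Longrightarrow> P (tadd s (tens U V u v))"
  shows "P t"
proof -
  obtain r us vs where t: "t = (\<lambda>B. \<Sum>i<(r::nat). tens U V (us i) (vs i) B)"
    using assms by (auto simp: tspace_def)
  have "P (\<lambda>B. \<Sum>i<(r::nat). tens U V (us i) (vs i) B)"
  proof (induction r)
    case (Suc r)
    have "(\<lambda>B. \<Sum>i<r. tens U V (us i) (vs i) B) \<in> tspace U V" unfolding tspace_def by blast
    from step[OF this Suc, of "us r" "vs r"] show ?case by (simp add: tadd_def)
  qed (simp add: assms(2))
  then show ?thesis by (simp add: t)
qed

lemma tens_in_tspace: "tens U V u v \<in> tspace U V"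
  using tadd_tens_in_tspace[OF zero_in_tspace, of u v] by (simp add: tadd_def)

lemma tadd_in_tspace:
  assumes "s \<in> tspace U V" "t \<in> tspace U V"
  shows "tadd s t \<in> tspace U V"
  using assms(2)
proof (induction rule: tspace_induct)
  case (tadd t u v)
  from tadd_tens_in_tspace[OF tadd(2), of u v] show ?case by (simp add: tadd_def add.assoc)
qed (simp add: tadd_def assms(1))

lemma tscale_in_tspace:
  assumes "t \<in> tspace U V"
  shows "tscale c t \<in> tspace U V"
  using assms
proof (induction rule: tspace_induct)
  case (tadd t u v)
  have "tscale c (Defs.tadd t (tens U V u v)) = Defs.tadd (tscale c t) (tens U V (scal U c u) v)"
    by (simp add: tens_scale_left) (simp add: tadd_def tscale_def algebra_simps)
  then show ?case using tadd_tens_in_tspace[OF tadd(2)] by simp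
qed (simp add: tscale_def zero_in_tspace)

lemma tspace_sum:
  assumes "finite I" "\<And>i. i \<in> I \<Longrightarrow> F i \<in> tspace U V"
  shows "(\<lambda>B. \<Sum>i\<in>I. F i B) \<in> tspace U V"
  using assms
proof induction
  case (insert i I)
  then have "tadd (F i) (\<lambda>B. \<Sum>i\<in>I. F i B) \<in> tspace U V" by (intro tadd_in_tspace) auto
  then show ?case using insert by (simp add: tadd_def)
qed (simp add: zero_in_tspace)

text \<open>A tensor is a function on arbitrary maps of two arguments; linearity in that argument is
  available only on bilinear forms.\<close>

lemma tspace_form_add:
  assumes "t \<in> tspace U V" "bilin U V B" "bilin U V B'"
  shows "t (\<lambda>u v. B u v + B' u v) = t B + t B'"
  using assms(1) by (induction rule: tspace_induct) (auto simp: tadd_def tens_def assms bilin_add)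

lemma tspace_form_scale:
  assumes "t \<in> tspace U V" "bilin U V B"
  shows "t (\<lambda>u v. c * B u v) = c * t B"
  using assms(1)
  by (induction rule: tspace_induct) (auto simp: tadd_def tens_def assms bilin_scale algebra_simps)

text \<open>Universal property of the tensor product. The value at t is the vector x with f x = t (f
  o b) for every functional f. Such an x is unique because functionals separate points, and exists
  by induction on t, so no choice of a representation of t enters.\<close>

lemma tensor_lift:
  fixes b :: "'u \<Rightarrow> 'v \<Rightarrow> 'k::ab_group_add"
  assumes "vector_space s"
    and b: "\<And>u u' v. b (u + u') v = b u v + b u' v" "\<And>u v v'. b u (v + v') = b u v + b u v'"
      "\<And>c u v. b (scal U c u) v = s c (b u v)" "\<And>c u v. b u (scal V c v) = s c (b u v)"
  obtains psi where "\<And>u v. psi (tens U V u v) = b u v"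
    and "\<And>t t'. t \<in> tspace U V \<Longrightarrow> t' \<in> tspace U V \<Longrightarrow> psi (tadd t t') = psi t + psi t'"
    and "\<And>c t. t \<in> tspace U V \<Longrightarrow> psi (tscale c t) = s c (psi t)"
proof -
  interpret K: vector_space s by fact
  let ?lin = "\<lambda>f. Vector_Spaces.linear s (times :: complex \<Rightarrow> _) f"
  let ?rep = "\<lambda>t x. \<forall>f. ?lin f \<longrightarrow> f x = t (\<lambda>u v. f (b u v))"
  have lin_add: "f (x + y) = f x + f y" and lin_scale: "f (s c x) = c * f x" if "?lin f" for f x y c
    using that linear_functional_iff[OF K.vector_space_axioms] by blast+
  have bil: "bilin U V (\<lambda>u v. f (b u v))" if "?lin f" for f
    by (auto simp: bilin_iff b lin_add[OF that] lin_scale[OF that])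
  have uniq: "x = y" if "?rep t x" "?rep t y" for t x y
    by (rule eq_if_linear_functionals_eq[OF K.vector_space_axioms]) (use that in auto)
  define psi where "psi t = (THE x. ?rep t x)" for t
  have psi: "psi t = x" if "?rep t x" for t x
    unfolding psi_def by (rule the_equality) (use that uniq in blast)+
  have rep_tens: "?rep (tens U V u v) (b u v)" for u v
    by (auto simp: tens_def bil)
  have rep_add: "?rep (tadd t t') (x + x')" if "?rep t x" "?rep t' x'" for t t' x x'
    using that by (auto simp: tadd_def lin_add)
  have ex: "\<exists>x. ?rep t x" if "t \<in> tspace U V" for t
    using that
  proof (induction rule: tspace_induct)
    case zero
    have "f 0 = 0" if "?lin f" for f using lin_scale[OF that, of 0 0] by simp
    then show ?case by auto
  next
    case (tadd t u v)
    then show ?case using rep_add rep_tens by blast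
  qed
  have rep: "?rep t (psi t)" if "t \<in> tspace U V" for t
    using ex[OF that] psi by metis
  show thesis
  proof
    show "psi (tens U V u v) = b u v" for u v by (intro psi rep_tens)
    show "psi (tadd t t') = psi t + psi t'" if "t \<in> tspace U V" "t' \<in> tspace U V" for t t'
      by (intro psi rep_add rep that)
    show "psi (tscale c t) = s c (psi t)" if "t \<in> tspace U V" for c t
      using rep[OF that] by (intro psi) (auto simp: tscale_def lin_scale)
  qed
qed

end

section \<open>Vertex operators of the twisted tensor product\<close>

locale twisted_tensor_product = tensor_product U V
  for U :: "('u::ab_group_add) nlva_data" and V :: "('v::ab_group_add) nlva_data" +
  fixes R :: "int \<Rightarrow> ('v, 'u) tensor \<Rightarrow> ('u, 'v) tensor"
  assumes twisting: "twisting_operator U V R"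
begin

sublocale VU: tensor_product V U ..

lemma R_in_tspace: "t \<in> tspace V U \<Longrightarrow> R n t \<in> tspace U V"
  and R_tadd: "s \<in> tspace V U \<Longrightarrow> t \<in> tspace V U \<Longrightarrow> R n (tadd s t) = tadd (R n s) (R n t)"
  and R_tscale: "t \<in> tspace V U \<Longrightarrow> R n (tscale c t) = tscale c (R n t)"
  and R_decomp_exists: "t \<in> tspace V U \<Longrightarrow> \<exists>r us vs fs. R_decomp U V R t r us vs fs"
  and R_vac: "R n (tens V U v (vac U)) = (if n = 0 then tens U V (vac U) v else (\<lambda>B. 0))"
  using twisting by (auto simp: twisting_operator_def)

lemma bilin_vop:
  assumes "bilin U V B"
  shows "bilin U V (\<lambda>q q'. B (vop U u p q) (vop V q' m v'))"
  using assms unfolding bilin_iff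
  by (simp add: U.vop_add_right U.vop_scale_right V.vop_add_left V.vop_scale_left)

text \<open>k is bounded below by the Laurent condition, p and n + k - 1 - p are bounded above by
  truncation, and these three bounds confine (k, p) to a finite box.\<close>

lemma R_decomp_bounds:
  assumes "R_decomp U V R (tens V U v u') r us vs fs"
  obtains C P Q :: int and S where
    "\<And>i k. i < r \<Longrightarrow> k < C \<Longrightarrow> fs i k = 0"
    "\<And>i p. i < r \<Longrightarrow> p \<ge> P \<Longrightarrow> vop U u p (us i) = 0"
    "\<And>i q. i < r \<Longrightarrow> q \<ge> Q \<Longrightarrow> vop V (vs i) q v' = 0"
    "finite S" "\<And>k p. C \<le> k \<Longrightarrow> p < P \<Longrightarrow> n + k - 1 - p < Q \<Longrightarrow> (k, p) \<in> S"
proof -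
  have "\<forall>i\<in>{..<r}. laurent (fs i)" using assms by (auto simp: R_decomp_def)
  then have "\<forall>i\<in>{..<r}. \<exists>N. \<forall>k<N. fs i k = 0" by (simp add: laurent_def)
  then obtain Cs where Cs: "\<And>i k. i < r \<Longrightarrow> k < Cs i \<Longrightarrow> fs i k = 0"
    by (metis lessThan_iff)
  define C where "C = Min (insert 0 (Cs ` {..<r}))"
  have C: "fs i k = 0" if "i < r" "k < C" for i k
    using that by (intro Cs) (auto simp: C_def)
  have "\<exists>P. \<forall>i\<in>{..<r}. \<forall>p\<ge>P. vop U u p (us i) = 0"
  proof -
    obtain Ps where Ps: "\<And>i p. p \<ge> Ps i \<Longrightarrow> vop U u p (us i) = 0"
      using U.vop_truncated[of u "us i" for i] by metis
    have "vop U u p (us i) = 0" if "i < r" "p \<ge> Max (insert 0 (Ps ` {..<r}))" for i p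
      using that by (intro Ps) auto
    then show ?thesis by blast
  qed
  then obtain P where P: "\<And>i p. i < r \<Longrightarrow> p \<ge> P \<Longrightarrow> vop U u p (us i) = 0" by auto
  have "\<exists>Q. \<forall>i\<in>{..<r}. \<forall>q\<ge>Q. vop V (vs i) q v' = 0"
    by (rule V.vop_truncated_finite) simp
  then obtain Q where Q: "\<And>i q. i < r \<Longrightarrow> q \<ge> Q \<Longrightarrow> vop V (vs i) q v' = 0" by auto
  show thesis
    by (rule that[where S = "{C..Q + P - n} \<times> {n + C - 1 - Q..P}", OF C P Q]) auto
qed

text \<open>\<open>Sum_any\<close> is additive only for finite supports, so this precedes linearity
  of \<open>YR_pure\<close>.\<close>

lemma YR_term_finite_support:
  assumes "bilin U V B"
  shows "finite {x. (case x of (k, p) \<Rightarrow> (-1) powi k *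
       R k (tens V U v u') (\<lambda>q q'. B (vop U u p q) (vop V q' (n + k - 1 - p) v'))) \<noteq> 0}"
proof -
  obtain r us vs fs where dec: "R_decomp U V R (tens V U v u') r us vs fs"
    using R_decomp_exists[OF VU.tens_in_tspace] by blast
  obtain C P Q :: int and S where S: "\<And>i k. i < r \<Longrightarrow> k < C \<Longrightarrow> fs i k = 0"
    "\<And>i p. i < r \<Longrightarrow> p \<ge> P \<Longrightarrow> vop U u p (us i) = 0"
    "\<And>i q. i < r \<Longrightarrow> q \<ge> Q \<Longrightarrow> vop V (vs i) q v' = 0"
    "finite S" "\<And>k p. C \<le> k \<Longrightarrow> p < P \<Longrightarrow> n + k - 1 - p < Q \<Longrightarrow> (k, p) \<in> S"
    using R_decomp_bounds[OF dec] by blast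
  have B0: "B 0 v = 0" "B u 0 = 0" for u v
    using assms unfolding bilin_iff by (metis add_cancel_right_left)+
  have "(k, p) \<in> S" if "R k (tens V U v u') (\<lambda>q q'. B (vop U u p q) (vop V q' (n + k - 1 - p) v')) \<noteq> 0"
    for k p
  proof (rule ccontr)
    assume "(k, p) \<notin> S"
    then have "k < C \<or> p \<ge> P \<or> n + k - 1 - p \<ge> Q" using S(5)[of k p] by linarith
    then have "fs i k * tens U V (us i) (vs i) (\<lambda>q q'. B (vop U u p q) (vop V q' (n + k - 1 - p) v')) = 0"
      if "i < r" for i
      using S(1-3)[OF that] by (auto simp: tens_def B0)
    then have "(\<Sum>i<r. fs i k * tens U V (us i) (vs i)
        (\<lambda>q q'. B (vop U u p q) (vop V q' (n + k - 1 - p) v'))) = 0"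
      by (intro sum.neutral ballI) auto
    then show False using that dec by (simp add: R_decomp_def)
  qed
  then show ?thesis by (intro finite_subset[OF _ S(4)]) auto
qed

lemma YR_pure_eq_sum:
  assumes dec: "R_decomp U V R (tens V U v u') r us vs fs" and B: "bilin U V B"
    and S: "\<And>i k. i < r \<Longrightarrow> k < C \<Longrightarrow> fs i k = 0"
    "\<And>i p. i < r \<Longrightarrow> p \<ge> P \<Longrightarrow> vop U u p (us i) = 0"
    "\<And>i q. i < r \<Longrightarrow> q \<ge> Q \<Longrightarrow> vop V (vs i) q v' = 0"
    "finite S" "\<And>k p. C \<le> k \<Longrightarrow> p < P \<Longrightarrow> n + k - 1 - p < Q \<Longrightarrow> (k, p) \<in> S"
  shows "YR_pure U V R u v n u' v' B = (\<Sum>i<r. \<Sum>(k, p)\<in>S.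
       (fs i k * (-1) powi k) * tens U V (vop U u p (us i)) (vop V (vs i) (n + k - 1 - p) v') B)"
proof -
  have B0: "B 0 v = 0" "B u 0 = 0" for u v
    using B unfolding bilin_iff by (metis add_cancel_right_left)+
  have R_eq: "R k (tens V U v u') (\<lambda>q q'. B (vop U u p q) (vop V q' (n + k - 1 - p) v'))
     = (\<Sum>i<r. fs i k * tens U V (vop U u p (us i)) (vop V (vs i) (n + k - 1 - p) v') B)" for k p
    using dec B bilin_vop[OF B] by (simp add: R_decomp_def tens_def)
  have zero: "fs i k * tens U V (vop U u p (us i)) (vop V (vs i) (n + k - 1 - p) v') B = 0"
    if "i < r" "(k, p) \<notin> S" for i k p
  proof -
    have "k < C \<or> p \<ge> P \<or> n + k - 1 - p \<ge> Q" using S(5)[of k p] that(2) by linarith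
    then show ?thesis using S(1-3)[OF that(1)] by (auto simp: tens_def B0)
  qed
  have "YR_pure U V R u v n u' v' B = (\<Sum>(k, p)\<in>S. (-1) powi k *
     (\<Sum>i<r. fs i k * tens U V (vop U u p (us i)) (vop V (vs i) (n + k - 1 - p) v') B))"
    unfolding YR_pure_def R_eq
  proof (rule Sum_any.expand_superset[OF S(4)], safe)
    fix k p
    assume *: "(-1) powi k * (\<Sum>i<r. fs i k *
       tens U V (vop U u p (us i)) (vop V (vs i) (n + k - 1 - p) v') B) \<noteq> 0"
    show "(k, p) \<in> S"
    proof (rule ccontr)
      assume "(k, p) \<notin> S"
      then have "(\<Sum>i<r. fs i k *
       tens U V (vop U u p (us i)) (vop V (vs i) (n + k - 1 - p) v') B) = 0"
        by (intro sum.neutral ballI zero) auto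
      then show False using * by simp
    qed
  qed
  also have "\<dots> = (\<Sum>(k, p)\<in>S. \<Sum>i<r.
       (fs i k * (-1) powi k) * tens U V (vop U u p (us i)) (vop V (vs i) (n + k - 1 - p) v') B)"
    by (intro sum.cong refl) (auto simp: sum_distrib_left mult_ac)
  also have "\<dots> = (\<Sum>i<r. \<Sum>(k, p)\<in>S.
       (fs i k * (-1) powi k) * tens U V (vop U u p (us i)) (vop V (vs i) (n + k - 1 - p) v') B)"
    unfolding case_prod_unfold by (rule sum.swap)
  finally show ?thesis .
qed

text \<open>Changing \<open>u\<close> or \<open>v'\<close> changes the bilinear form to which a
  value of \<open>R\<close> is applied; changing \<open>v\<close> or \<open>u'\<close> changes the
  argument of \<open>R\<close>, which is linear.\<close>

lemma YR_pure_add: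
  assumes "bilin U V B"
  shows "YR_pure U V R (u1 + u2) v n u' v' B = YR_pure U V R u1 v n u' v' B + YR_pure U V R u2 v n u' v' B"
    and "YR_pure U V R u (v1 + v2) n u' v' B = YR_pure U V R u v1 n u' v' B + YR_pure U V R u v2 n u' v' B"
    and "YR_pure U V R u v n (u1 + u2) v' B = YR_pure U V R u v n u1 v' B + YR_pure U V R u v n u2 v' B"
    and "YR_pure U V R u v n u' (v1 + v2) B = YR_pure U V R u v n u' v1 B + YR_pure U V R u v n u' v2 B"
proof -
  note fin = YR_term_finite_support[OF assms] and RT = R_in_tspace[OF VU.tens_in_tspace]
  note add = assms[unfolded bilin_iff]
  show "YR_pure U V R (u1 + u2) v n u' v' B = YR_pure U V R u1 v n u' v' B + YR_pure U V R u2 v n u' v' B"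
    unfolding YR_pure_def Sum_any.distrib[OF fin fin, symmetric]
    by (intro Sum_any.cong)
      (auto simp: U.vop_add_left add tspace_form_add[OF RT bilin_vop bilin_vop, OF assms assms] algebra_simps)
  show "YR_pure U V R u v n u' (v1 + v2) B = YR_pure U V R u v n u' v1 B + YR_pure U V R u v n u' v2 B"
    unfolding YR_pure_def Sum_any.distrib[OF fin fin, symmetric]
    by (intro Sum_any.cong)
      (auto simp: V.vop_add_right add tspace_form_add[OF RT bilin_vop bilin_vop, OF assms assms] algebra_simps)
  show "YR_pure U V R u (v1 + v2) n u' v' B = YR_pure U V R u v1 n u' v' B + YR_pure U V R u v2 n u' v' B"
    unfolding YR_pure_def Sum_any.distrib[OF fin fin, symmetric]
    by (intro Sum_any.cong)
      (clarsimp simp: VU.tens_add_left R_tadd VU.tens_in_tspace, simp add: tadd_def algebra_simps)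
  show "YR_pure U V R u v n (u1 + u2) v' B = YR_pure U V R u v n u1 v' B + YR_pure U V R u v n u2 v' B"
    unfolding YR_pure_def Sum_any.distrib[OF fin fin, symmetric]
    by (intro Sum_any.cong)
      (clarsimp simp: VU.tens_add_right R_tadd VU.tens_in_tspace, simp add: tadd_def algebra_simps)
qed

lemma YR_pure_scale:
  assumes "bilin U V B"
  shows "YR_pure U V R (scal U c u) v n u' v' B = c * YR_pure U V R u v n u' v' B"
    and "YR_pure U V R u (scal V c v) n u' v' B = c * YR_pure U V R u v n u' v' B"
    and "YR_pure U V R u v n (scal U c u') v' B = c * YR_pure U V R u v n u' v' B"
    and "YR_pure U V R u v n u' (scal V c v') B = c * YR_pure U V R u v n u' v' B"
proof -
  note fin = YR_term_finite_support[OF assms] and RT = R_in_tspace[OF VU.tens_in_tspace]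
  note scale = assms[unfolded bilin_iff]
  show "YR_pure U V R (scal U c u) v n u' v' B = c * YR_pure U V R u v n u' v' B"
    unfolding YR_pure_def Sum_any_right_distrib[OF fin]
    by (intro Sum_any.cong)
      (auto simp: U.vop_scale_left scale tspace_form_scale[OF RT bilin_vop, OF assms])
  show "YR_pure U V R u v n u' (scal V c v') B = c * YR_pure U V R u v n u' v' B"
    unfolding YR_pure_def Sum_any_right_distrib[OF fin]
    by (intro Sum_any.cong)
      (auto simp: V.vop_scale_right scale tspace_form_scale[OF RT bilin_vop, OF assms])
  show "YR_pure U V R u (scal V c v) n u' v' B = c * YR_pure U V R u v n u' v' B"
    unfolding YR_pure_def Sum_any_right_distrib[OF fin]
    by (intro Sum_any.cong)
      (clarsimp simp: VU.tens_scale_left R_tscale VU.tens_in_tspace, simp add: tscale_def)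
  show "YR_pure U V R u v n (scal U c u') v' B = c * YR_pure U V R u v n u' v' B"
    unfolding YR_pure_def Sum_any_right_distrib[OF fin]
    by (intro Sum_any.cong)
      (clarsimp simp: VU.tens_scale_right R_tscale VU.tens_in_tspace, simp add: tscale_def)
qed

text \<open>\<open>tens\<close> returns 0 on maps that are not bilinear, so \<open>YR\<close> has
  its intended value on elementary tensors only once both its inner maps are known to be
  bilinear.\<close>

lemma bilin_YR_pure_right: "bilin U V B \<Longrightarrow> bilin U V (\<lambda>u' v'. YR_pure U V R u v n u' v' B)"
  by (subst bilin_iff) (simp add: YR_pure_add YR_pure_scale)

lemma bilin_YR_pure_left:
  assumes "bilin U V B" "t \<in> tspace U V"
  shows "bilin U V (\<lambda>u v. t (\<lambda>u' v'. YR_pure U V R u v n u' v' B))"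
  by (subst bilin_iff) (simp add: assms YR_pure_add YR_pure_scale
      tspace_form_add[OF assms(2)] tspace_form_scale[OF assms(2)] bilin_YR_pure_right)

lemma YR_tens_left:
  assumes "t \<in> tspace U V"
  shows "YR U V R (tens U V u v) n t
       = (\<lambda>B. if bilin U V B then t (\<lambda>u' v'. YR_pure U V R u v n u' v' B) else 0)"
  using assms by (auto simp: YR_def tens_def bilin_YR_pure_left fun_eq_iff)

lemma YR_tens_tens:
  "YR U V R (tens U V u v) n (tens U V u' v')
     = (\<lambda>B. if bilin U V B then YR_pure U V R u v n u' v' B else 0)"
  by (auto simp: YR_tens_left tens_in_tspace fun_eq_iff) (simp add: tens_def bilin_YR_pure_right)

text \<open>A finite sum of elementary tensors, to which a linear map on the tensor product can be
  applied term by term.\<close>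

lemma YR_tens_tens_eq_sum:
  assumes dec: "R_decomp U V R (tens V U v u') r us vs fs"
    and S: "\<And>i k. i < r \<Longrightarrow> k < C \<Longrightarrow> fs i k = 0"
    "\<And>i p. i < r \<Longrightarrow> p \<ge> P \<Longrightarrow> vop U u p (us i) = 0"
    "\<And>i q. i < r \<Longrightarrow> q \<ge> Q \<Longrightarrow> vop V (vs i) q v' = 0"
    "finite S" "\<And>k p. C \<le> k \<Longrightarrow> p < P \<Longrightarrow> n + k - 1 - p < Q \<Longrightarrow> (k, p) \<in> S"
  shows "YR U V R (tens U V u v) n (tens U V u' v') = (\<lambda>B. \<Sum>(i, k, p)\<in>{..<r} \<times> S.
       tscale (fs i k * (-1) powi k)
         (tens U V (vop U u p (us i)) (vop V (vs i) (n + k - 1 - p) v')) B)"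
proof
  fix B
  show "YR U V R (tens U V u v) n (tens U V u' v') B = (\<Sum>(i, k, p)\<in>{..<r} \<times> S.
       tscale (fs i k * (-1) powi k)
         (tens U V (vop U u p (us i)) (vop V (vs i) (n + k - 1 - p) v')) B)"
  proof (cases "bilin U V B")
    case True
    have "YR U V R (tens U V u v) n (tens U V u' v') B = YR_pure U V R u v n u' v' B"
      using True by (simp add: YR_tens_tens)
    also have "\<dots> = (\<Sum>i<r. \<Sum>(k, p)\<in>S. (fs i k * (-1) powi k) *
         tens U V (vop U u p (us i)) (vop V (vs i) (n + k - 1 - p) v') B)"
      using dec True S by (rule YR_pure_eq_sum)
    finally show ?thesis by (simp add: tscale_def sum.cartesian_product)
  next
    case False
    then have "tens U V x y B = 0" for x y by (simp add: tens_def)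
    then show ?thesis using False by (simp add: YR_tens_tens tscale_def case_prod_unfold)
  qed
qed

text \<open>R(x) fixes the tensor of the vacua, which leaves k = 0; the vacuum operator of
  \<open>V\<close> then forces p = -1. Uniqueness rests on this identity.\<close>

lemma YR_tens_vac_vac_tens: "YR U V R (tens U V u (vac V)) (-1) (tens U V (vac U) v) = tens U V u v"
proof
  fix B
  show "YR U V R (tens U V u (vac V)) (-1) (tens U V (vac U) v) B = tens U V u v B"
  proof (cases "bilin U V B")
    case True
    have B0: "B x 0 = 0" for x
      using True unfolding bilin_iff by (metis add_cancel_right_left)
    let ?g = "\<lambda>(k, p). (-1) powi k * R k (tens V U (vac V) (vac U))
        (\<lambda>q q'. B (vop U u p q) (vop V q' (-1 + k - 1 - p) v))"
    have g: "?g (k, p) = (if k = 0 \<and> p = -1 then B u v else 0)" for k p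
      using True by (simp add: R_vac) (auto simp: tens_def bilin_vop V.vop_vac B0)
    then have "YR_pure U V R u (vac V) (-1) (vac U) v B = (\<Sum>x\<in>{(0, -1)}. ?g x)"
      unfolding YR_pure_def by (intro Sum_any.expand_superset) (auto split: if_splits)
    also have "\<dots> = ?g (0, -1)" by simp
    also have "\<dots> = B u v" by (simp only: g) simp
    finally show ?thesis using True by (simp only: YR_tens_tens) (simp add: tens_def)
  qed (simp add: YR_def tens_def)
qed

lemma YR_tadd_left: "YR U V R (tadd s t) n t' = tadd (YR U V R s n t') (YR U V R t n t')"
  by (auto simp: YR_def tadd_def)

lemma YR_tens_tadd_right:
  assumes "t \<in> tspace U V" "t' \<in> tspace U V"
  shows "YR U V R (tens U V u v) n (tadd t t')
       = tadd (YR U V R (tens U V u v) n t) (YR U V R (tens U V u v) n t')"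
  by (simp only: YR_tens_left tadd_in_tspace assms) (auto simp: tadd_def)

end

section \<open>The induced homomorphism and its uniqueness\<close>

theorem theorem2p7:
  fixes U :: "('u::ab_group_add) nlva_data"
    and V :: "('v::ab_group_add) nlva_data"
    and K :: "('k::ab_group_add) nlva_data"
    and R :: "int \<Rightarrow> ('v, 'u) tensor \<Rightarrow> ('u, 'v) tensor"
    and psi1 :: "'u \<Rightarrow> 'k" and psi2 :: "'v \<Rightarrow> 'k"
  assumes "nlva U" and "nlva V" and "nlva K"
    and "twisting_operator U V R"
    and "nlva_hom U K psi1" and "nlva_hom V K psi2"
    and "\<And>u v n. n \<ge> 0 \<Longrightarrow> vop K (psi1 u) n (psi2 v) = 0"
    and "\<And>u v r us vs fs n. R_decomp U V R (tens V U v u) r us vs fs \<Longrightarrow>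
           vop K (psi2 v) n (psi1 u) = exp_D_coeff K (skew_series K psi1 psi2 r us vs fs) n"
  shows "\<exists>psi :: ('u, 'v) tensor \<Rightarrow> 'k.
           (\<forall>u v. psi (tens U V u v) = vop K (psi1 u) (-1) (psi2 v)) \<and>
           hom_on (tspace U V) tadd tscale (YR U V R) (tens U V (vac U) (vac V)) K psi \<and>
           (\<forall>u. psi (tens U V u (vac V)) = psi1 u) \<and>
           (\<forall>v. psi (tens U V (vac U) v) = psi2 v) \<and>
           (\<forall>phi. hom_on (tspace U V) tadd tscale (YR U V R) (tens U V (vac U) (vac V)) K phi \<and>
                  (\<forall>u. phi (tens U V u (vac V)) = psi1 u) \<and>
                  (\<forall>v. phi (tens U V (vac U) v) = psi2 v)
                  \<longrightarrow> (\<forall>t\<in>tspace U V. phi t = psi t))"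
proof -
  interpret K: nonlocal_vertex_algebra K by unfold_locales fact
  interpret twisted_tensor_product U V R by unfold_locales fact+
  have psi1: "psi1 (u + u') = psi1 u + psi1 u'" "psi1 (scal U c u) = scal K c (psi1 u)"
    "psi1 (vac U) = vac K" "psi1 (vop U u n u') = vop K (psi1 u) n (psi1 u')" for u u' c n
    using \<open>nlva_hom U K psi1\<close> by (auto simp: nlva_hom_def hom_on_def)
  have psi2: "psi2 (v + v') = psi2 v + psi2 v'" "psi2 (scal V c v) = scal K c (psi2 v)"
    "psi2 (vac V) = vac K" "psi2 (vop V v n v') = vop K (psi2 v) n (psi2 v')" for v v' c n
    using \<open>nlva_hom V K psi2\<close> by (auto simp: nlva_hom_def hom_on_def)
  have psi1_0: "psi1 0 = 0" using psi1(1)[of 0 0] by simp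
  have psi2_0: "psi2 0 = 0" using psi2(1)[of 0 0] by simp
  note regular = assms(7)
  obtain psi where psi_tens: "\<And>u v. psi (tens U V u v) = vop K (psi1 u) (-1) (psi2 v)"
    and psi_tadd: "\<And>t t'. t \<in> tspace U V \<Longrightarrow> t' \<in> tspace U V \<Longrightarrow> psi (tadd t t') = psi t + psi t'"
    and psi_tscale: "\<And>c t. t \<in> tspace U V \<Longrightarrow> psi (tscale c t) = scal K c (psi t)"
    by (rule tensor_lift[OF K.vector_space_axioms, of "\<lambda>u v. vop K (psi1 u) (-1) (psi2 v)"])
      (auto simp: psi1 psi2 K.vop_add_left K.vop_add_right K.vop_scale_left K.vop_scale_right)
  have psi_0: "psi (\<lambda>B. 0) = 0"
    using psi_tadd[OF zero_in_tspace zero_in_tspace] by (simp add: tadd_def)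
  have psi_sum: "psi (\<lambda>B. \<Sum>i\<in>I. F i B) = (\<Sum>i\<in>I. psi (F i))"
    if "finite I" "\<And>i. i \<in> I \<Longrightarrow> F i \<in> tspace U V" for I :: "(nat \<times> int \<times> int) set" and F
    using that
  proof induction
    case (insert i I)
    then show ?case
      using psi_tadd[of "F i" "\<lambda>B. \<Sum>i\<in>I. F i B"] by (simp add: tadd_def tspace_sum)
  qed (simp add: psi_0)
  \<comment> \<open>Membership in \<open>tspace\<close> is proved alongside, since
    \<open>psi\<close> is known to be additive only there.\<close>
  have YR_tens: "YR U V R (tens U V u v) n (tens U V u' v') \<in> tspace U V
      \<and> psi (YR U V R (tens U V u v) n (tens U V u' v'))
        = vop K (psi (tens U V u v)) n (psi (tens U V u' v'))" for u v u' v' n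
  proof -
    obtain r us vs fs where dec: "R_decomp U V R (tens V U v u') r us vs fs"
      using R_decomp_exists[OF VU.tens_in_tspace] by blast
    obtain C P Q :: int and S where S: "\<And>i k. i < r \<Longrightarrow> k < C \<Longrightarrow> fs i k = 0"
      "\<And>i p. i < r \<Longrightarrow> p \<ge> P \<Longrightarrow> vop U u p (us i) = 0"
      "\<And>i q. i < r \<Longrightarrow> q \<ge> Q \<Longrightarrow> vop V (vs i) q v' = 0"
      "finite S" "\<And>k p. C \<le> k \<Longrightarrow> p < P \<Longrightarrow> n + k - 1 - p < Q \<Longrightarrow> (k, p) \<in> S"
      using R_decomp_bounds[OF dec] by blast
    \<comment> \<open>The lemmas inside \<open>K\<close> use \<open>id\<close> for both maps, so
      \<open>psi1\<close> and \<open>psi2\<close> are absorbed into the families a_i and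
      c_i.\<close>
    have skew: "skew_series K psi1 psi2 r us vs fs
        = skew_series K id id r (\<lambda>i. psi1 (us i)) (\<lambda>i. psi2 (vs i)) fs"
      by (simp add: skew_series_def fun_eq_iff)
    let ?F = "\<lambda>(i, k, p). tscale (fs i k * (-1) powi k)
         (tens U V (vop U u p (us i)) (vop V (vs i) (n + k - 1 - p) v'))"
    have YR: "YR U V R (tens U V u v) n (tens U V u' v') = (\<lambda>B. \<Sum>x\<in>{..<r} \<times> S. ?F x B)"
      using YR_tens_tens_eq_sum[OF dec S] by (simp add: case_prod_unfold)
    have F: "?F x \<in> tspace U V" for x
      by (auto simp: case_prod_unfold tscale_in_tspace tens_in_tspace)
    have "psi (YR U V R (tens U V u v) n (tens U V u' v')) = (\<Sum>x\<in>{..<r} \<times> S. psi (?F x))"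
      unfolding YR using S(4) F by (intro psi_sum) auto
    also have "\<dots> = (\<Sum>i<r. \<Sum>(k, p)\<in>S. scal K (fs i k * (-1) powi k)
         (vop K (vop K (psi1 u) p (psi1 (us i))) (-1) (vop K (psi2 (vs i)) (n + k - 1 - p) (psi2 v'))))"
      by (simp add: sum.cartesian_product case_prod_unfold psi_tscale tens_in_tspace psi_tens psi1 psi2)
    also have "\<dots> = vop K (vop K (psi1 u) (-1) (psi2 v)) n (vop K (psi1 u') (-1) (psi2 v'))"
    proof (rule K.vop_m1_vop_m1_skew[symmetric, where C = C and P = P and Q = Q])
      show "vop K (psi2 v) m (psi1 u')
        = exp_D_coeff K (skew_series K id id r (\<lambda>i. psi1 (us i)) (\<lambda>i. psi2 (vs i)) fs) m" for m
        using assms(8)[OF dec] by (simp add: skew)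
      show "vop K (psi2 (vs i)) m (psi2 v') = 0" if "i < r" "m \<ge> Q" for i m
        using S(3)[OF that] by (metis psi2(4) psi2_0)
      show "vop K (psi1 u) m (psi1 (us i)) = 0" if "i < r" "m \<ge> P" for i m
        using S(2)[OF that] by (metis psi1(4) psi1_0)
    \<comment> \<open>Read backwards, the homomorphism laws bring every remaining regularity
      condition into the form psi1(x)_n psi2(y) = 0.\<close>
    qed (use S in \<open>auto simp: regular simp flip: psi1(4) psi2(4)\<close>)
    finally show ?thesis using S(4) F by (auto simp: YR psi_tens intro!: tspace_sum)
  qed
  \<comment> \<open>Multiplicativity extends from elementary tensors first in the right argument,
    then in the left one.\<close>
  have YR_tens_left: "YR U V R (tens U V u v) n t \<in> tspace U V
      \<and> psi (YR U V R (tens U V u v) n t) = vop K (psi (tens U V u v)) n (psi t)"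
    if "t \<in> tspace U V" for u v n t
    using that
  proof (induction rule: tspace_induct)
    case zero
    have "YR U V R (tens U V u v) n (\<lambda>B. 0) = (\<lambda>B. 0)"
      by (auto simp: YR_tens_left zero_in_tspace)
    then show ?case by (simp add: zero_in_tspace psi_0)
  next
    case (tadd t u' v')
    then show ?case using YR_tens[of u v n u' v']
      by (simp add: YR_tens_tadd_right tens_in_tspace tadd_in_tspace psi_tadd K.vop_add_right)
  qed
  have YR: "YR U V R t n t' \<in> tspace U V \<and> psi (YR U V R t n t') = vop K (psi t) n (psi t')"
    if "t \<in> tspace U V" "t' \<in> tspace U V" for n t t'
    using that(1)
  proof (induction rule: tspace_induct)
    case zero
    have "YR U V R (\<lambda>B. 0) n t' = (\<lambda>B. 0)" by (auto simp: YR_def)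
    then show ?case by (simp add: zero_in_tspace psi_0)
  next
    case (tadd t u v)
    then show ?case using YR_tens_left[OF that(2), of u v n]
      by (simp add: YR_tadd_left tens_in_tspace tadd_in_tspace psi_tadd K.vop_add_left)
  qed
  have psi_left: "psi (tens U V u (vac V)) = psi1 u" for u
    by (simp add: psi_tens psi2)
  have psi_right: "psi (tens U V (vac U) v) = psi2 v" for v
    by (simp add: psi_tens psi1 K.vop_vac)
  have hom: "hom_on (tspace U V) tadd tscale (YR U V R) (tens U V (vac U) (vac V)) K psi"
    by (auto simp: hom_on_def psi_tadd psi_tscale YR psi_left psi1)
  have uniq: "phi t = psi t"
    if phi: "hom_on (tspace U V) tadd tscale (YR U V R) (tens U V (vac U) (vac V)) K phi"
      and left: "\<And>u. phi (tens U V u (vac V)) = psi1 u"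
      and right: "\<And>v. phi (tens U V (vac U) v) = psi2 v" and "t \<in> tspace U V" for phi t
    using \<open>t \<in> tspace U V\<close>
  proof (induction rule: tspace_induct)
    case zero
    have "phi (tadd (\<lambda>B. 0) (\<lambda>B. 0)) = phi (\<lambda>B. 0) + phi (\<lambda>B. 0)"
      using phi zero_in_tspace unfolding hom_on_def by blast
    then show ?case by (simp add: tadd_def psi_0)
  next
    case (tadd t u v)
    \<comment> \<open>This determines \<open>phi\<close> on u (x) v = (u (x) 1)_{-1} (1 (x) v) by
      its values on the two factors.\<close>
    have "phi (YR U V R (tens U V u (vac V)) (-1) (tens U V (vac U) v))
        = vop K (phi (tens U V u (vac V))) (-1) (phi (tens U V (vac U) v))"
      using phi tens_in_tspace unfolding hom_on_def by blast
    then have "phi (tens U V u v) = psi (tens U V u v)"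
      by (simp add: YR_tens_vac_vac_tens left right psi_tens)
    moreover have "phi (Defs.tadd t (tens U V u v)) = phi t + phi (tens U V u v)"
      using phi tens_in_tspace tadd(1) unfolding hom_on_def by blast
    ultimately show ?case using tadd by (simp add: psi_tadd tens_in_tspace)
  qed
  show ?thesis
    using psi_tens hom psi_left psi_right uniq by blast
qed

end
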